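(* Let $(G,\star,\circ)$ be a finite skew left brace. Let $a:(G,\circ)\to(\Gamma,\cdot)$ be an isomorphism of groups with inverse $b:(\Gamma,\cdot)\to(G,\circ)$. Let $L/K$ be a Galois extension of fields with Galois group $(\Gamma,\cdot)$. Let $H$ be the $K$-Hopf algebra giving the unique Hopf Galois structure on $L/K$ of type $(G,\star)$ corresponding to the isomorphism $a$. Then there is a bijection between the set of $K$-sub-Hopf algebras of $H$ and the set of $\circ$-stable subgroups $G'$ of $(G,\star)$.
   Context: A finite skew left brace $(G,\star,\circ)$ is a finite set $G$ with two group operations $\star$ and $\circ$ such that for all $g,h,k\in G$, $g\circ(h\star k)=(g\circ h)\star g^{-1}\star(g\circ k)$, where $g^{-1}$ is the inverse of $g$ in $(G,\star)$; $(G,\star)$ is called the additive group. For $g\in G$ let $\lambda_\star(g),\lambda_\circ(g)\in\mathrm{Perm}(G)$ be $\lambda_\star(g)(h)=g\star h$ and $\lambda_\circ(g)(h)=g\circ h$. A subgroup $G'$ of $(G,\star)$ is $\circ$-stable if $\lambda_\star(G')$ is closed under conjugation in $\mathrm{Perm}(G)$ by $\lambda_\circ(g)$ for all $g\in G$; equivalently, $(g\circ g')\star g^{-1}\in G'$ for all $g\in G$, $g'\in G'$. Hopf Galois structures: let $L/K$ be a Galois extension of fields with finite Galois group $\Gamma$. For a cocommutative $K$-Hopf algebra $H$, $L/K$ is an $H$-Hopf Galois extension if $L$ is an $H$-module algebra and the map $L\otimes_K H\to\mathrm{End}_K(L)$, $x\otimes h\mapsto(y\mapsto x\,h(y))$,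 is an isomorphism. Let $\lambda:\Gamma\to\mathrm{Perm}(\Gamma)$ be the left regular representation, $\lambda(\gamma)(\delta)=\gamma\delta$. By Greither and Pareigis, Hopf Galois structures on $L/K$ are in bijection with regular subgroups $N$ of $\mathrm{Perm}(\Gamma)$ normalized by $\lambda(\Gamma)$: the Hopf algebra corresponding to $N$ is $H=(L[N])^\Gamma$, the fixed ring of the group ring $L[N]$ under the action of $\Gamma$ that is the Galois action on $L$ and conjugation by $\lambda(\gamma)$ on $N$; then $L\otimes_K H\cong L[N]$. The structure has type $G$ if $N\cong G$. The Hopf Galois structure of type $(G,\star)$ corresponding to the isomorphism $a$ is the one given by $N=\alpha(G)$, where $\alpha:(G,\star)\to\mathrm{Perm}(\Gamma)$ is $\alpha(g)=a\,\lambda_\star(g)\,a^{-1}$; this $N$ is a regular subgroup of $\mathrm{Perm}(\Gamma)$ isomorphic to $(G,\star)$ and normalized by $\lambda(\Gamma)$. *)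

theory Defs
  imports
    "HOL-Algebra.Bij"
    "HOL-Library.Function_Algebras"
    "HOL-Computational_Algebra.Polynomial"
begin

section \<open>Skew left braces\<close>

locale skew_left_brace = add: group A + circ: group C
  for A :: "('g, 'm) monoid_scheme" and C :: "('g, 'n) monoid_scheme" +
  assumes carrier_eq: "carrier C = carrier A"
    and brace: "\<lbrakk>g \<in> carrier A; h \<in> carrier A; k \<in> carrier A\<rbrakk> \<Longrightarrow>
      g \<otimes>\<^bsub>C\<^esub> (h \<otimes>\<^bsub>A\<^esub> k) = (g \<otimes>\<^bsub>C\<^esub> h) \<otimes>\<^bsub>A\<^esub> inv\<^bsub>A\<^esub> g \<otimes>\<^bsub>A\<^esub> (g \<otimes>\<^bsub>C\<^esub> k)"

definition left_reg :: "('g, 'm) monoid_scheme \<Rightarrow> 'g \<Rightarrow> ('g \<Rightarrow> 'g)" where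
  "left_reg G g = (\<lambda>h \<in> carrier G. g \<otimes>\<^bsub>G\<^esub> h)"

definition circ_stable_subgroup ::
    "('g, 'm) monoid_scheme \<Rightarrow> ('g, 'n) monoid_scheme \<Rightarrow> 'g set \<Rightarrow> bool" where
  "circ_stable_subgroup A C G' \<longleftrightarrow> subgroup G' A \<and>
     (let P = BijGroup (carrier A) in
      \<forall>g \<in> carrier A. \<forall>p \<in> left_reg A ` G'.
        left_reg C g \<otimes>\<^bsub>P\<^esub> p \<otimes>\<^bsub>P\<^esub> inv\<^bsub>P\<^esub> (left_reg C g) \<in> left_reg A ` G')"

section \<open>Galois extensions\<close>

definition field_hom :: "('a::field \<Rightarrow> 'b::field) \<Rightarrow> bool" where
  "field_hom f \<longleftrightarrow> f 1 = 1 \<and> (\<forall>x y. f (x + y) = f x + f y) \<and> (\<forall>x y. f (x * y) = f x * f y)"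

text \<open>An extension of fields \<open>L/K\<close> is given by an embedding \<open>\<iota>\<close> of a field \<open>'k\<close> into
  a field \<open>'l\<close>.\<close>

definition galois_group :: "('k::field \<Rightarrow> 'l::field) \<Rightarrow> ('l \<Rightarrow> 'l) monoid" where
  "galois_group \<iota> =
     \<lparr>carrier = {\<sigma>. field_hom \<sigma> \<and> bij \<sigma> \<and> (\<forall>k. \<sigma> (\<iota> k) = \<iota> k)}, monoid.mult = (\<circ>), one = id\<rparr>"

definition galois_extension :: "('k::field \<Rightarrow> 'l::field) \<Rightarrow> bool" where
  "galois_extension \<iota> \<longleftrightarrow> field_hom \<iota> \<and>
     (\<forall>x. \<exists>p. p \<noteq> 0 \<and> poly (map_poly \<iota> p) x = 0) \<and>
     {x. \<forall>\<sigma> \<in> carrier (galois_group \<iota>). \<sigma> x = x} = range \<iota>"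

section \<open>Tensor products\<close>

text \<open>Vector spaces are subspaces \<open>V\<close> of a type \<open>'v\<close> with scalar multiplication \<open>s\<close>.
  The tensor product of \<open>V\<close> and \<open>W\<close> is the free vector space on \<open>V \<times> W\<close> modulo the
  bilinearity relations; its elements are cosets.\<close>

definition single :: "'a \<Rightarrow> 'a \<Rightarrow> 'k::field" where
  "single a = (\<lambda>b. if b = a then 1 else 0)"

definition pscale :: "'k::field \<Rightarrow> ('a \<Rightarrow> 'k) \<Rightarrow> ('a \<Rightarrow> 'k)" where
  "pscale c u = (\<lambda>a. c * u a)"

definition free_space :: "'a set \<Rightarrow> ('a \<Rightarrow> 'k::field) set" where
  "free_space X = {u. finite {a. u a \<noteq> 0} \<and> {a. u a \<noteq> 0} \<subseteq> X}"

definition tensor_relations ::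
    "('k::field \<Rightarrow> 'v::ab_group_add \<Rightarrow> 'v) \<Rightarrow> 'v set \<Rightarrow>
     ('k \<Rightarrow> 'w::ab_group_add \<Rightarrow> 'w) \<Rightarrow> 'w set \<Rightarrow> ('v \<times> 'w \<Rightarrow> 'k) set" where
  "tensor_relations s V t W =
     {single (x + x', y) - single (x, y) - single (x', y) | x x' y. x \<in> V \<and> x' \<in> V \<and> y \<in> W}
   \<union> {single (x, y + y') - single (x, y) - single (x, y') | x y y'. x \<in> V \<and> y \<in> W \<and> y' \<in> W}
   \<union> {single (s c x, y) - pscale c (single (x, y)) | c x y. x \<in> V \<and> y \<in> W}
   \<union> {single (x, t c y) - pscale c (single (x, y)) | c x y. x \<in> V \<and> y \<in> W}"

definition tensor_class ::
    "('k::field \<Rightarrow> 'v::ab_group_add \<Rightarrow> 'v) \<Rightarrow> 'v set \<Rightarrow>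
     ('k \<Rightarrow> 'w::ab_group_add \<Rightarrow> 'w) \<Rightarrow> 'w set \<Rightarrow> ('v \<times> 'w \<Rightarrow> 'k) \<Rightarrow> ('v \<times> 'w \<Rightarrow> 'k) set" where
  "tensor_class s V t W u = {w. w - u \<in> module.span pscale (tensor_relations s V t W)}"

definition tensor_product ::
    "('k::field \<Rightarrow> 'v::ab_group_add \<Rightarrow> 'v) \<Rightarrow> 'v set \<Rightarrow>
     ('k \<Rightarrow> 'w::ab_group_add \<Rightarrow> 'w) \<Rightarrow> 'w set \<Rightarrow> ('v \<times> 'w \<Rightarrow> 'k) set set" where
  "tensor_product s V t W = tensor_class s V t W ` free_space (V \<times> W)"

section \<open>Hopf algebras\<close>

text \<open>The underlying vector space of a Hopf algebra is a subspace \<open>carrier H\<close> of the type \<open>'v\<close>;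
  its addition is that of \<open>'v\<close>.\<close>

record ('k, 'v) hopf_algebra = "'v monoid" +
  scale :: "'k \<Rightarrow> 'v \<Rightarrow> 'v"
  comult :: "'v \<Rightarrow> ('v \<times> 'v \<Rightarrow> 'k) set"
  counit :: "'v \<Rightarrow> 'k"
  antipode :: "'v \<Rightarrow> 'v"

abbreviation hopf_tensor_class ::
    "('k::field, 'v::ab_group_add) hopf_algebra \<Rightarrow> ('v \<times> 'v \<Rightarrow> 'k) \<Rightarrow> ('v \<times> 'v \<Rightarrow> 'k) set" where
  "hopf_tensor_class H \<equiv> tensor_class (scale H) (carrier H) (scale H) (carrier H)"

abbreviation hopf_tensor_square ::
    "('k::field, 'v::ab_group_add) hopf_algebra \<Rightarrow> ('v \<times> 'v \<Rightarrow> 'k) set set" where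
  "hopf_tensor_square H \<equiv> tensor_product (scale H) (carrier H) (scale H) (carrier H)"

text \<open>In the condition on \<open>comult\<close>, the image of \<open>B \<otimes> B\<close> in \<open>H \<otimes> H\<close> consists of
  the classes in \<open>H \<otimes> H\<close> of formal sums supported in \<open>B \<times> B\<close>.\<close>

definition sub_hopf_algebra ::
    "'v set \<Rightarrow> ('k::field, 'v::ab_group_add) hopf_algebra \<Rightarrow> bool" where
  "sub_hopf_algebra B H \<longleftrightarrow>
     B \<subseteq> carrier H \<and> module.subspace (scale H) B \<and>
     \<one>\<^bsub>H\<^esub> \<in> B \<and> (\<forall>x \<in> B. \<forall>y \<in> B. x \<otimes>\<^bsub>H\<^esub> y \<in> B) \<and>
     (\<forall>x \<in> B. comult H x \<in> hopf_tensor_class H ` free_space (B \<times> B)) \<and>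
     (\<forall>x \<in> B. antipode H x \<in> B)"

text \<open>The group algebra \<open>L[N]\<close> of a finite group \<open>N\<close>; the element \<open>\<Sum>n. f n \<cdot> n\<close> is represented
  by the function \<open>f\<close>, extended by zero outside \<open>N\<close>.\<close>

definition group_algebra_carrier :: "('n, 'm) monoid_scheme \<Rightarrow> ('n \<Rightarrow> 'l::field) set" where
  "group_algebra_carrier N = {f. \<forall>n. n \<notin> carrier N \<longrightarrow> f n = 0}"

definition group_algebra :: "('n, 'm) monoid_scheme \<Rightarrow> ('l::field, 'n \<Rightarrow> 'l) hopf_algebra" where
  "group_algebra N =
    \<lparr>carrier = group_algebra_carrier N,
     monoid.mult = (\<lambda>f g x.
       \<Sum>(y, z) \<in> {(y, z) \<in> carrier N \<times> carrier N. y \<otimes>\<^bsub>N\<^esub> z = x}. f y * g z),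
     one = single \<one>\<^bsub>N\<^esub>,
     scale = pscale,
     comult = (\<lambda>f.
       tensor_class pscale (group_algebra_carrier N) pscale (group_algebra_carrier N)
         (\<Sum>n \<in> carrier N. pscale (f n) (single (single n, single n)))),
     counit = (\<lambda>f. \<Sum>n \<in> carrier N. f n),
     antipode = (\<lambda>f n. if n \<in> carrier N then f (inv\<^bsub>N\<^esub> n) else 0)\<rparr>"

section \<open>Greither--Pareigis descent\<close>

definition base_change ::
    "('k::field \<Rightarrow> 'l::field) \<Rightarrow> ('l, 'v::ab_group_add) hopf_algebra \<Rightarrow>
     ('v \<times> 'v \<Rightarrow> 'k) set \<Rightarrow> ('v \<times> 'v \<Rightarrow> 'l) set" where
  \<comment> \<open>For a \<open>K\<close>-subspace \<open>V\<close> of \<open>E\<close>, this is the canonical map from \<open>V \<otimes>\<^sub>K V\<close> to \<open>E \<otimes>\<^sub>L E\<close>;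
     the class on the right does not depend on the representative \<open>u\<close> of \<open>\<tau>\<close>.\<close>
  "base_change \<iota> E \<tau> = the_elem ((\<lambda>u. hopf_tensor_class E (\<iota> \<circ> u)) ` \<tau>)"

definition perm_subgroup :: "('k::field \<Rightarrow> 'l::field) \<Rightarrow> (('l \<Rightarrow> 'l) \<Rightarrow> ('l \<Rightarrow> 'l)) set \<Rightarrow>
    (('l \<Rightarrow> 'l) \<Rightarrow> ('l \<Rightarrow> 'l)) monoid" where
  "perm_subgroup \<iota> N = (BijGroup (carrier (galois_group \<iota>)))\<lparr>carrier := N\<rparr>"

definition galois_action :: "('k::field \<Rightarrow> 'l::field) \<Rightarrow> (('l \<Rightarrow> 'l) \<Rightarrow> ('l \<Rightarrow> 'l)) set \<Rightarrow>
    ('l \<Rightarrow> 'l) \<Rightarrow> ((('l \<Rightarrow> 'l) \<Rightarrow> ('l \<Rightarrow> 'l)) \<Rightarrow> 'l) \<Rightarrow> ((('l \<Rightarrow> 'l) \<Rightarrow> ('l \<Rightarrow> 'l)) \<Rightarrow> 'l)" where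
  \<comment> \<open>\<open>\<Sum>n. f n \<cdot> n\<close> is sent to \<open>\<Sum>n. \<sigma> (f n) \<cdot> \<lambda>(\<sigma>) n \<lambda>(\<sigma>)\<^sup>-\<^sup>1\<close>, so that the coefficient at \<open>n\<close>
     is \<open>\<sigma> (f (\<lambda>(\<sigma>)\<^sup>-\<^sup>1 n \<lambda>(\<sigma>)))\<close>.\<close>
  "galois_action \<iota> N \<sigma> f =
     (let \<Gamma> = galois_group \<iota>; P = BijGroup (carrier \<Gamma>); l = left_reg \<Gamma> \<sigma> in
      (\<lambda>n. if n \<in> N then \<sigma> (f (inv\<^bsub>P\<^esub> l \<otimes>\<^bsub>P\<^esub> n \<otimes>\<^bsub>P\<^esub> l)) else 0))"

definition fixed_ring :: "('k::field \<Rightarrow> 'l::field) \<Rightarrow> (('l \<Rightarrow> 'l) \<Rightarrow> ('l \<Rightarrow> 'l)) set \<Rightarrow>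
    ((('l \<Rightarrow> 'l) \<Rightarrow> ('l \<Rightarrow> 'l)) \<Rightarrow> 'l) set" where
  "fixed_ring \<iota> N = {f \<in> carrier (group_algebra (perm_subgroup \<iota> N)).
     \<forall>\<sigma> \<in> carrier (galois_group \<iota>). galois_action \<iota> N \<sigma> f = f}"

text \<open>The \<open>K\<close>-Hopf algebra \<open>H = (L[N])\<^sup>\<Gamma>\<close>. Its operations are those of \<open>L[N]\<close>, restricted;
  in particular its comultiplication is the lift of that of \<open>L[N]\<close> along the canonical map from
  \<open>H \<otimes>\<^sub>K H\<close> to \<open>L[N] \<otimes>\<^sub>L L[N]\<close>, which by Galois descent is injective with the
  \<open>\<Gamma>\<close>-invariants as its image.\<close>

definition descent_hopf_algebra ::
    "('k::field \<Rightarrow> 'l::field) \<Rightarrow> (('l \<Rightarrow> 'l) \<Rightarrow> ('l \<Rightarrow> 'l)) set \<Rightarrow>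
     ('k, (('l \<Rightarrow> 'l) \<Rightarrow> ('l \<Rightarrow> 'l)) \<Rightarrow> 'l) hopf_algebra" where
  "descent_hopf_algebra \<iota> N =
    (let E = group_algebra (perm_subgroup \<iota> N); V = fixed_ring \<iota> N; s = (\<lambda>c. scale E (\<iota> c)) in
     \<lparr>carrier = V,
      monoid.mult = monoid.mult E,
      one = \<one>\<^bsub>E\<^esub>,
      scale = s,
      comult = (\<lambda>f. the_inv_into (tensor_product s V s V) (base_change \<iota> E) (comult E f)),
      counit = (\<lambda>f. the_inv \<iota> (counit E f)),
      antipode = antipode E\<rparr>)"

text \<open>For mutually inverse isomorphisms \<open>a\<close> and \<open>b\<close>, the map \<open>\<alpha>(g) = a \<lambda>\<^sub>\<star>(g) a\<^sup>-\<^sup>1\<close>.\<close>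

definition conj_left_reg :: "('g, 'm) monoid_scheme \<Rightarrow> ('c, 'n) monoid_scheme \<Rightarrow>
    ('g \<Rightarrow> 'c) \<Rightarrow> ('c \<Rightarrow> 'g) \<Rightarrow> 'g \<Rightarrow> ('c \<Rightarrow> 'c)" where
  "conj_left_reg A \<Gamma> a b g = compose (carrier \<Gamma>) a (compose (carrier \<Gamma>) (left_reg A g) b)"

definition brace_hopf_algebra ::
    "('k::field \<Rightarrow> 'l::field) \<Rightarrow> ('g, 'm) monoid_scheme \<Rightarrow> ('g \<Rightarrow> ('l \<Rightarrow> 'l)) \<Rightarrow> (('l \<Rightarrow> 'l) \<Rightarrow> 'g) \<Rightarrow>
     ('k, (('l \<Rightarrow> 'l) \<Rightarrow> ('l \<Rightarrow> 'l)) \<Rightarrow> 'l) hopf_algebra" where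
  "brace_hopf_algebra \<iota> A a b =
     descent_hopf_algebra \<iota> (conj_left_reg A (galois_group \<iota>) a b ` carrier A)"

end

theory Submission
  imports Defs
begin

text \<open>
  Write \<open>N = \<alpha>(G)\<close>; the Hopf algebra \<open>H\<close> is the set of \<open>\<Gamma>\<close>-invariants of \<open>L[N]\<close>, where \<open>\<Gamma>\<close> acts on
  \<open>L\<close> and, by conjugation, on \<open>N\<close>. An element of \<open>L[N]\<close> is a function on \<open>N\<close>, and a sub-Hopf algebra
  \<open>B\<close> of \<open>H\<close> is determined by the set \<open>S \<subseteq> N\<close> of points at which some element of \<open>B\<close> does not
  vanish: \<open>B\<close> consists of all invariants with support in \<open>S\<close>. The sets that occur are the subgroups
  of \<open>N\<close> that are stable under \<open>\<Gamma>\<close>, and the brace identity translates these into the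
  \<open>\<circ>\<close>-stable subgroups of \<open>(G, \<star>)\<close>.

  The reason is that the group elements are grouplike. If \<open>f \<in> B\<close>, then \<open>\<Delta> f\<close> is the diagonal function
  on \<open>N \<times> N\<close> with entries \<open>f n\<close>, and it is a sum of terms \<open>y \<otimes> z\<close> with \<open>y, z \<in> B\<close>; its row of index
  \<open>n\<close> exhibits \<open>f n \<cdot> n\<close> as an \<open>L\<close>-combination of elements of \<open>B\<close> (\<open>single_in_span\<close>). So the \<open>L\<close>-span
  of \<open>B\<close> is spanned by \<open>S\<close>, and Galois descent recovers \<open>B\<close> from its \<open>L\<close>-span
  (\<open>span_invariants\<close>). Closure of \<open>B\<close> under products and antipode makes \<open>S\<close> a subgroup.
  Conversely, the invariants supported in a stable subgroup form a sub-Hopf algebra because their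
  comultiplications have representatives with both factors supported there
  (\<open>comult_lift_exists\<close>).

  Descent is made explicit by two families of constants. There are \<open>c\<^sub>j, d\<^sub>j \<in> L\<close> such that
  \<open>\<Sum>\<^sub>j \<sigma>(c\<^sub>j) d\<^sub>j\<close> is \<open>1\<close> for \<open>\<sigma> = id\<close> and \<open>0\<close> for all other \<open>\<sigma> \<in> \<Gamma>\<close>
  (\<open>dual_system_exists\<close>); with them every \<open>n \<in> N\<close> is a combination of the invariants
  \<open>\<Sum>\<^sub>\<sigma> \<sigma>(c\<^sub>j) \<cdot> \<sigma>n\<close>. And there is \<open>e \<in> L\<close> of trace \<open>1\<close>; multiplying by \<open>e\<close> and summing over
  \<open>\<Gamma>\<close> turns an \<open>L\<close>-linear relation between invariants into a \<open>K\<close>-linear one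
  (\<open>trace_average\<close>). The same constants give generators and coordinates of the space of invariants
  over \<open>K\<close>, from which it follows that \<open>H \<otimes>\<^sub>K H \<rightarrow> L[N] \<otimes>\<^sub>L L[N]\<close> is injective
  (\<open>invariants_tensor_kernel\<close>), so that the comultiplication of \<open>H\<close> can be read off from functions
  on \<open>N \<times> N\<close> (\<open>comult_H_iff\<close>).
\<close>

section \<open>Finite Galois extensions\<close>

lemma field_hom_one: "field_hom f \<Longrightarrow> f 1 = 1"
  and field_hom_add: "field_hom f \<Longrightarrow> f (x + y) = f x + f y"
  and field_hom_mult: "field_hom f \<Longrightarrow> f (x * y) = f x * f y"
  by (auto simp: field_hom_def)

lemma field_hom_zero: "field_hom f \<Longrightarrow> f 0 = 0"
  using field_hom_add[of f 0 0] by (metis add_0 add_cancel_right_left)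

lemma field_hom_diff: "field_hom f \<Longrightarrow> f (x - y) = f x - f y"
  using field_hom_add[of f "x - y" y] by (simp add: algebra_simps)

lemma field_hom_eq_zero: "field_hom f \<Longrightarrow> f x = 0 \<longleftrightarrow> x = 0"
  using field_hom_mult[of f x "inverse x"]
  by (cases "x = 0") (auto simp: field_hom_zero field_hom_one)

lemma field_hom_inj: "field_hom f \<Longrightarrow> inj f"
  using field_hom_diff[of f] field_hom_eq_zero[of f]
  by (intro injI) (metis eq_iff_diff_eq_0)

lemma field_hom_sum: "field_hom f \<Longrightarrow> f (sum g S) = (\<Sum>x\<in>S. f (g x))"
  by (induction S rule: infinite_finite_induct) (auto simp: field_hom_zero field_hom_add)

lemma field_hom_divide: "field_hom f \<Longrightarrow> f (x / y) = f x / f y"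
  using field_hom_mult[of f "x / y" y]
  by (cases "y = 0") (auto simp: field_hom_zero field_hom_eq_zero field_simps)

lemma field_hom_id: "field_hom id"
  by (simp add: field_hom_def)

lemmas field_hom_simps = field_hom_one field_hom_add field_hom_mult field_hom_zero
  field_hom_diff field_hom_eq_zero field_hom_sum field_hom_divide

lemma galois_group_is_group: "group (galois_group \<iota>)"
proof (rule groupI)
  show "\<exists>\<tau>\<in>carrier (galois_group \<iota>). \<tau> \<otimes>\<^bsub>galois_group \<iota>\<^esub> \<sigma> = \<one>\<^bsub>galois_group \<iota>\<^esub>"
    if "\<sigma> \<in> carrier (galois_group \<iota>)" for \<sigma>
  proof -
    have \<sigma>: "field_hom \<sigma>" "bij \<sigma>" "\<And>k. \<sigma> (\<iota> k) = \<iota> k"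
      using that by (auto simp: galois_group_def)
    define \<tau> where "\<tau> = the_inv \<sigma>"
    have inv: "\<sigma> (\<tau> x) = x" "\<tau> (\<sigma> x) = x" for x
      using \<sigma>(2) unfolding \<tau>_def
      by (simp_all add: bij_is_surj bij_is_inj f_the_inv_into_f the_inv_f_f)
    have "field_hom \<tau>"
      unfolding field_hom_def
      by (metis inv field_hom_one[OF \<sigma>(1)] field_hom_add[OF \<sigma>(1)] field_hom_mult[OF \<sigma>(1)])
    moreover have "\<tau> (\<iota> k) = \<iota> k" for k
      using \<sigma>(3) inv(2) by metis
    moreover have "bij \<tau>"
      by (rule bij_betw_byWitness[of _ \<sigma>]) (auto simp: inv)
    ultimately have "\<tau> \<in> carrier (galois_group \<iota>)"
      by (simp add: galois_group_def)
    moreover have "\<tau> \<otimes>\<^bsub>galois_group \<iota>\<^esub> \<sigma> = \<one>\<^bsub>galois_group \<iota>\<^esub>"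
      using inv(2) by (auto simp: galois_group_def)
    ultimately show ?thesis by blast
  qed
qed (auto simp: galois_group_def field_hom_def bij_comp o_assoc)

locale finite_galois_extension =
  fixes \<iota> :: "'k::field \<Rightarrow> 'l::field"
  assumes galois: "galois_extension \<iota>"
    and finite_galois_group: "finite (carrier (galois_group \<iota>))"
begin

abbreviation \<Gamma> :: "('l \<Rightarrow> 'l) set" where "\<Gamma> \<equiv> carrier (galois_group \<iota>)"

sublocale gal: group "galois_group \<iota>"
  by (rule galois_group_is_group)

lemma base_field_hom: "field_hom \<iota>"
  using galois by (simp add: galois_extension_def)

lemma galois_field_hom: "\<sigma> \<in> \<Gamma> \<Longrightarrow> field_hom \<sigma>"
  by (simp add: galois_group_def)

lemmas base_simps = field_hom_simps[OF base_field_hom]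
lemmas galois_simps = field_hom_simps[OF galois_field_hom]

lemma galois_fixes_base: "\<sigma> \<in> \<Gamma> \<Longrightarrow> \<sigma> (\<iota> k) = \<iota> k"
  by (simp add: galois_group_def)

lemma fixed_by_galois_iff: "(\<forall>\<sigma>\<in>\<Gamma>. \<sigma> x = x) \<longleftrightarrow> x \<in> range \<iota>"
  using galois unfolding galois_extension_def by auto

lemma galois_mult: "\<sigma> \<otimes>\<^bsub>galois_group \<iota>\<^esub> \<tau> = \<sigma> \<circ> \<tau>"
  and galois_one: "\<one>\<^bsub>galois_group \<iota>\<^esub> = id"
  by (simp_all add: galois_group_def)

lemma id_in_galois: "id \<in> \<Gamma>"
  using gal.one_closed by (simp add: galois_one)

lemma comp_in_galois: "\<sigma> \<in> \<Gamma> \<Longrightarrow> \<tau> \<in> \<Gamma> \<Longrightarrow> \<sigma> \<circ> \<tau> \<in> \<Gamma>"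
  using gal.m_closed by (simp add: galois_mult)

lemma galois_inverse:
  assumes "\<sigma> \<in> \<Gamma>"
  obtains \<tau> where "\<tau> \<in> \<Gamma>" "\<sigma> \<circ> \<tau> = id" "\<tau> \<circ> \<sigma> = id"
  using gal.inv_closed[OF assms] gal.l_inv[OF assms] gal.r_inv[OF assms]
  by (simp add: galois_mult galois_one)

lemma galois_reindex:
  assumes "\<tau> \<in> \<Gamma>"
  shows "(\<Sum>\<sigma>\<in>\<Gamma>. f (\<tau> \<circ> \<sigma>)) = (\<Sum>\<sigma>\<in>\<Gamma>. f \<sigma>)"
proof -
  obtain \<rho> where \<rho>: "\<rho> \<in> \<Gamma>" "\<tau> \<circ> \<rho> = id" "\<rho> \<circ> \<tau> = id"
    using galois_inverse[OF assms] by metis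
  show ?thesis
    by (rule sum.reindex_bij_witness[of _ "\<lambda>\<sigma>. \<rho> \<circ> \<sigma>" "\<lambda>\<sigma>. \<tau> \<circ> \<sigma>"])
      (use assms \<rho> in \<open>simp_all add: comp_in_galois o_assoc\<close>)
qed

definition trace :: "'l \<Rightarrow> 'k" where
  "trace x = the_inv \<iota> (\<Sum>\<sigma>\<in>\<Gamma>. \<sigma> x)"

lemma base_trace: "\<iota> (trace x) = (\<Sum>\<sigma>\<in>\<Gamma>. \<sigma> x)"
proof -
  have "\<tau> (\<Sum>\<sigma>\<in>\<Gamma>. \<sigma> x) = (\<Sum>\<sigma>\<in>\<Gamma>. \<sigma> x)" if "\<tau> \<in> \<Gamma>" for \<tau>
    using galois_reindex[OF that, of "\<lambda>\<sigma>. \<sigma> x"] by (simp add: galois_simps that)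
  then have "(\<Sum>\<sigma>\<in>\<Gamma>. \<sigma> x) \<in> range \<iota>"
    using fixed_by_galois_iff by blast
  then show ?thesis
    unfolding trace_def by (intro f_the_inv_into_f field_hom_inj base_field_hom)
qed

text \<open>The sums \<open>\<sigma> \<mapsto> \<Sum>\<^sub>j \<sigma>(c\<^sub>j) d\<^sub>j\<close> are closed under multiplication, so it suffices to separate
  \<open>id\<close> from one automorphism at a time: if \<open>\<tau>(x) \<noteq> x\<close>, then
  \<open>\<sigma> \<mapsto> (\<sigma>(x) - \<tau>(x)) / (x - \<tau>(x))\<close> is \<open>1\<close> at \<open>id\<close> and \<open>0\<close> at \<open>\<tau>\<close>.\<close>

lemma separating_coefficients:
  assumes "finite S" and "id \<notin> S" and "S \<subseteq> \<Gamma>"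
  shows "\<exists>(m::nat) c d. (\<forall>\<sigma>\<in>S. (\<Sum>j<m. \<sigma> (c j) * d j) = 0) \<and> (\<Sum>j<m. c j * d j) = 1"
  using assms
proof (induction S rule: finite_induct)
  case empty
  show ?case
    by (intro exI[of _ "Suc 0"] exI[of _ "\<lambda>_. 1"]) simp
next
  case (insert \<tau> S)
  then obtain m :: nat and c d where
    IH: "\<And>\<sigma>. \<sigma> \<in> S \<Longrightarrow> (\<Sum>j<m. \<sigma> (c j) * d j) = 0" "(\<Sum>j<m. c j * d j) = 1"
    by (metis insert_iff insert_subset)
  obtain x where x: "\<tau> x \<noteq> x"
    using insert.prems by (metis eq_id_iff insertI1)
  define c' where "c' j = (if j < m then x * c j else c (j - m))" for j
  define d' where "d' j = (if j < m then d j else - \<tau> x * d (j - m)) / (x - \<tau> x)" for j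
  \<comment> \<open>Doubling the number of terms multiplies the represented function by \<open>\<sigma> \<mapsto> (\<sigma> x - \<tau> x) / (x - \<tau> x)\<close>.\<close>
  have *: "(\<Sum>j<m + m. \<sigma> (c' j) * d' j) = (\<sigma> x - \<tau> x) / (x - \<tau> x) * (\<Sum>j<m. \<sigma> (c j) * d j)"
    if "field_hom \<sigma>" for \<sigma>
  proof -
    have "(\<Sum>j<m + m. \<sigma> (c' j) * d' j)
        = (\<Sum>j<m. \<sigma> (c' j) * d' j) + (\<Sum>j<m. \<sigma> (c' (m + j)) * d' (m + j))"
      using sum.atLeastLessThan_concat[of 0 m "m + m" "\<lambda>j. \<sigma> (c' j) * d' j"]
        sum.shift_bounds_nat_ivl[of "\<lambda>j. \<sigma> (c' j) * d' j" 0 m m]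
      by (simp add: lessThan_atLeast0 add.commute)
    also have "\<dots> = (\<Sum>j<m. \<sigma> x / (x - \<tau> x) * (\<sigma> (c j) * d j))
        + (\<Sum>j<m. - \<tau> x / (x - \<tau> x) * (\<sigma> (c j) * d j))"
      by (intro arg_cong2[where f = "(+)"] sum.cong)
        (auto simp: c'_def d'_def field_hom_simps[OF that])
    also have "\<dots> = (\<sigma> x - \<tau> x) / (x - \<tau> x) * (\<Sum>j<m. \<sigma> (c j) * d j)"
      unfolding sum_distrib_left[symmetric] by (simp add: diff_divide_distrib algebra_simps)
    finally show ?thesis .
  qed
  have "(\<Sum>j<m + m. \<sigma> (c' j) * d' j) = 0" if "\<sigma> \<in> insert \<tau> S" for \<sigma>
    using *[of \<sigma>] IH(1)[of \<sigma>] that insert.prems galois_field_hom by auto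
  moreover have "(\<Sum>j<m + m. c' j * d' j) = 1"
    using *[OF field_hom_id] x IH(2) by simp
  ultimately show ?case
    by blast
qed

text \<open>The existence of such a system is the criterion of Chase, Harrison and Rosenberg for \<open>L/K\<close> to
  be Galois with group \<open>\<Gamma>\<close>.\<close>

definition dual_system :: "nat \<Rightarrow> (nat \<Rightarrow> 'l) \<Rightarrow> (nat \<Rightarrow> 'l) \<Rightarrow> bool" where
  "dual_system m c d \<longleftrightarrow>
     (\<forall>\<sigma>\<in>\<Gamma>. (\<Sum>j<m. \<sigma> (c j) * d j) = (if \<sigma> = id then 1 else 0))"

lemma dual_system_sum:
  "dual_system m c d \<Longrightarrow> \<sigma> \<in> \<Gamma> \<Longrightarrow> (\<Sum>j<m. \<sigma> (c j) * d j) = (if \<sigma> = id then 1 else 0)"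
  unfolding dual_system_def by (erule bspec)

lemma dual_system_exists: obtains m c d where "dual_system m c d"
proof -
  obtain m :: nat and c d where
    cd: "\<forall>\<sigma>\<in>\<Gamma> - {id}. (\<Sum>j<m. \<sigma> (c j) * d j) = 0" "(\<Sum>j<m. c j * d j) = 1"
    using separating_coefficients[of "\<Gamma> - {id}"] finite_galois_group by auto
  have "dual_system m c d"
    unfolding dual_system_def
  proof
    show "(\<Sum>j<m. \<sigma> (c j) * d j) = (if \<sigma> = id then 1 else 0)" if "\<sigma> \<in> \<Gamma>" for \<sigma>
    proof (cases "\<sigma> = id")
      case True
      show ?thesis
        unfolding True id_apply using cd(2) by simp
    next
      case False
      then show ?thesis
        using bspec[OF cd(1), of \<sigma>] that by simp
    qed
  qed
  then show ?thesis
    by (rule that)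
qed

text \<open>If the trace vanished on every \<open>c\<^sub>j\<close> of a dual system, summing the defining relations over \<open>\<Gamma>\<close>
  would give \<open>0 = 1\<close>.\<close>

lemma trace_surjective: obtains e where "trace e = 1"
proof -
  obtain m c d where dual: "dual_system m c d"
    by (rule dual_system_exists)
  have "(\<Sum>j<m. \<iota> (trace (c j)) * d j) = (\<Sum>\<sigma>\<in>\<Gamma>. \<Sum>j<m. \<sigma> (c j) * d j)"
    unfolding base_trace sum_distrib_right by (rule sum.swap)
  also have "\<dots> = (\<Sum>\<sigma>\<in>\<Gamma>. if \<sigma> = id then 1 else 0)"
    by (intro sum.cong refl dual_system_sum[OF dual])
  also have "\<dots> = 1"
    using finite_galois_group id_in_galois by simp
  finally have nonzero: "(\<Sum>j<m. \<iota> (trace (c j)) * d j) = 1" .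
  obtain j where "trace (c j) \<noteq> 0"
  proof (rule ccontr)
    assume "\<not> thesis"
    then have "trace (c j) = 0" for j
      using that by blast
    then show False
      using nonzero by (simp add: base_simps)
  qed
  define k where "k = trace (c j)"
  have "\<iota> (trace (c j / \<iota> k)) = (\<Sum>\<sigma>\<in>\<Gamma>. \<sigma> (c j)) / \<iota> k"
    unfolding base_trace by (simp add: galois_simps galois_fixes_base sum_divide_distrib)
  also have "\<dots> = \<iota> 1"
    using \<open>trace (c j) \<noteq> 0\<close> by (simp add: base_simps k_def flip: base_trace)
  finally have "trace (c j / \<iota> k) = 1"
    using field_hom_inj[OF base_field_hom] by (simp add: inj_eq)
  then show ?thesis
    by (rule that)
qed

text \<open>Averaging turns a relation over \<open>L\<close> between \<open>\<Gamma>\<close>-equivariant functions into one over \<open>K\<close>: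
  multiplying \<open>F = \<Sum>\<^sub>i r\<^sub>i y\<^sub>i\<close> by \<open>e\<close>, applying each \<open>\<sigma> \<in> \<Gamma>\<close> and adding up leaves \<open>F\<close>
  unchanged, since \<open>e\<close> has trace \<open>1\<close>, and replaces \<open>r\<^sub>i\<close> by the trace of \<open>e r\<^sub>i\<close>.\<close>

lemma trace_average:
  assumes e: "trace e = 1"
    and F: "\<And>p. F p = (\<Sum>i\<in>I. r i * y i p)"
    and equivariant: "\<And>\<sigma>. \<sigma> \<in> \<Gamma> \<Longrightarrow> \<exists>p'. F p = \<sigma> (F p') \<and> (\<forall>i\<in>I. y i p = \<sigma> (y i p'))"
  shows "F p = (\<Sum>i\<in>I. \<iota> (trace (e * r i)) * y i p)"
proof -
  have *: "(\<Sum>i\<in>I. \<sigma> (e * r i) * y i p) = \<sigma> e * F p" if \<sigma>: "\<sigma> \<in> \<Gamma>" for \<sigma>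
  proof -
    obtain p' where p': "F p = \<sigma> (F p')" "\<And>i. i \<in> I \<Longrightarrow> y i p = \<sigma> (y i p')"
      using equivariant[OF \<sigma>] by metis
    have "(\<Sum>i\<in>I. \<sigma> (e * r i) * y i p) = (\<Sum>i\<in>I. \<sigma> e * \<sigma> (r i * y i p'))"
      by (intro sum.cong) (simp_all add: galois_simps[OF \<sigma>] p'(2) mult.assoc)
    also have "\<dots> = \<sigma> e * F p"
      unfolding p'(1) F[of p'] by (simp add: galois_simps(7)[OF \<sigma>] sum_distrib_left)
    finally show ?thesis .
  qed
  have "(\<Sum>i\<in>I. \<iota> (trace (e * r i)) * y i p) = (\<Sum>\<sigma>\<in>\<Gamma>. \<Sum>i\<in>I. \<sigma> (e * r i) * y i p)"
    unfolding base_trace sum_distrib_right by (rule sum.swap)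
  also have "\<dots> = (\<Sum>\<sigma>\<in>\<Gamma>. \<sigma> e) * F p"
    by (simp add: * sum_distrib_right)
  also have "\<dots> = F p"
    unfolding base_trace[symmetric] e by (simp add: base_simps)
  finally show ?thesis ..
qed

end

section \<open>Coordinates in tensor products\<close>

lemma sum_fun_apply: "(sum f S) x = (\<Sum>a\<in>S. f a x)"
  by (induction S rule: infinite_finite_induct) simp_all

lemma single_simps [simp]:
  "single a a = 1" "b \<noteq> a \<Longrightarrow> single a b = 0"
  by (simp_all add: single_def)

lemma pscale_apply: "pscale c u x = c * u x"
  by (simp add: pscale_def)

lemma vector_space_pscale: "field_hom \<eta> \<Longrightarrow> vector_space (\<lambda>c. pscale (\<eta> c))"
  by unfold_locales (auto simp: fun_eq_iff pscale_apply field_hom_simps algebra_simps)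

interpretation fun_space: vector_space pscale
  using vector_space_pscale[OF field_hom_id] by simp

lemma single_in_free_space: "a \<in> X \<Longrightarrow> single a \<in> free_space X"
  by (auto simp: free_space_def single_def intro: finite_subset[of _ "{a}"])

lemma free_space_subspace: "fun_space.subspace (free_space X)"
proof (rule fun_space.subspaceI)
  fix u v :: "'b \<Rightarrow> 'a" and c :: 'a
  assume u: "u \<in> free_space X"
  have "{a. pscale c u a \<noteq> 0} \<subseteq> {a. u a \<noteq> 0}"
    by (auto simp: pscale_apply)
  then show "pscale c u \<in> free_space X"
    using u unfolding free_space_def by (blast intro: finite_subset)
  assume v: "v \<in> free_space X"
  have "{a. (u + v) a \<noteq> 0} \<subseteq> {a. u a \<noteq> 0} \<union> {a. v a \<noteq> 0}"
    by auto
  then show "u + v \<in> free_space X"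
    using u v unfolding free_space_def by (blast intro: finite_subset)
qed (simp add: free_space_def)

lemma free_space_expansion:
  "u \<in> free_space X \<Longrightarrow> u = (\<Sum>z\<in>{z. u z \<noteq> 0}. pscale (u z) (single z))"
  by (auto simp: fun_eq_iff sum_fun_apply pscale_apply free_space_def single_def if_distrib cong: if_cong)

text \<open>Every generator \<open>x \<otimes> y\<close> reduces, by bilinearity, to the combination
  \<open>\<Sum>\<^sub>i\<^sub>j \<phi>\<^sub>i(x) \<psi>\<^sub>j(y) (h\<^sub>i \<otimes> h'\<^sub>j)\<close>. So a formal sum is a consequence of the
  relations as soon as its total coordinates vanish.\<close>

lemma in_span_tensor_relations:
  fixes s :: "'k::field \<Rightarrow> 'v::ab_group_add \<Rightarrow> 'v" and t :: "'k \<Rightarrow> 'w::ab_group_add \<Rightarrow> 'w"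
  assumes s: "vector_space s" and t: "vector_space t"
    and V: "module.subspace s V" and W: "module.subspace t W"
    and fin: "finite I" "finite J"
    and h: "\<And>i. i \<in> I \<Longrightarrow> h i \<in> V" and h': "\<And>j. j \<in> J \<Longrightarrow> h' j \<in> W"
    and \<phi>: "\<And>x. x \<in> V \<Longrightarrow> x = (\<Sum>i\<in>I. s (\<phi> i x) (h i))"
    and \<psi>: "\<And>y. y \<in> W \<Longrightarrow> y = (\<Sum>j\<in>J. t (\<psi> j y) (h' j))"
    and u: "u \<in> free_space (V \<times> W)"
    and vanish: "\<And>i j. i \<in> I \<Longrightarrow> j \<in> J \<Longrightarrow>
      (\<Sum>z\<in>{z. u z \<noteq> 0}. u z * (\<phi> i (fst z) * \<psi> j (snd z))) = 0"
  shows "u \<in> fun_space.span (tensor_relations s V t W)"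
proof -
  interpret s: vector_space s by (rule s)
  interpret t: vector_space t by (rule t)
  define R where "R = fun_space.span (tensor_relations s V t W)"
  have base: "r \<in> R" if "r \<in> tensor_relations s V t W" for r
    using that unfolding R_def by (rule fun_space.span_base)
  have R: "fun_space.subspace R"
    unfolding R_def by (rule fun_space.subspace_span)
  note R_add = fun_space.subspace_add[OF R] and R_scale = fun_space.subspace_scale[OF R]
    and R_neg = fun_space.subspace_neg[OF R]
  have left_add: "single (x + x', y) - single (x, y) - single (x', y) \<in> R"
    if "x \<in> V" "x' \<in> V" "y \<in> W" for x x' y
    using that by (intro base) (auto simp: tensor_relations_def)
  have right_add: "single (x, y + y') - single (x, y) - single (x, y') \<in> R"
    if "x \<in> V" "y \<in> W" "y' \<in> W" for x y y'
    using that by (intro base) (auto simp: tensor_relations_def)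
  have left_scale: "single (s c x, y) - pscale c (single (x, y)) \<in> R"
    if "x \<in> V" "y \<in> W" for c x y
    using that by (intro base) (auto simp: tensor_relations_def)
  have right_scale: "single (x, t c y) - pscale c (single (x, y)) \<in> R"
    if "x \<in> V" "y \<in> W" for c x y
    using that by (intro base) (auto simp: tensor_relations_def)
  have regroup: "(a - b - d) + (b - e) + (d - f) = a - (e + f)"
    for a b d e f :: "'v \<times> 'w \<Rightarrow> 'k"
    by (simp add: algebra_simps)
  have left: "single (\<Sum>i\<in>I'. s (c i) (h i), y) - (\<Sum>i\<in>I'. pscale (c i) (single (h i, y))) \<in> R"
    if "finite I'" "I' \<subseteq> I" and y: "y \<in> W" for I' c y
    using that(1,2)
  proof (induction I' rule: finite_induct)
    case empty
    show ?case
      using R_neg[OF left_add[OF s.subspace_0[OF V] s.subspace_0[OF V] y]] by simp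
  next
    case (insert i I')
    have sum_V: "(\<Sum>i\<in>I'. s (c i) (h i)) \<in> V"
      using insert.prems h by (intro s.subspace_sum[OF V] s.subspace_scale[OF V]) auto
    have i: "h i \<in> V"
      using insert.prems h by auto
    let ?a = "single (s (c i) (h i) + (\<Sum>i\<in>I'. s (c i) (h i)), y)"
      and ?b = "single (s (c i) (h i), y)"
      and ?d = "single (\<Sum>i\<in>I'. s (c i) (h i), y)"
    have "(?a - ?b - ?d) + (?b - pscale (c i) (single (h i, y)))
        + (?d - (\<Sum>i\<in>I'. pscale (c i) (single (h i, y)))) \<in> R"
      using insert.prems
      by (intro R_add left_add left_scale s.subspace_scale[OF V] i sum_V y insert.IH) blast
    then show ?case
      unfolding sum.insert[OF insert.hyps] regroup .
  qed
  have right: "single (x, \<Sum>j\<in>J'. t (c j) (h' j)) - (\<Sum>j\<in>J'. pscale (c j) (single (x, h' j))) \<in> R"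
    if "finite J'" "J' \<subseteq> J" and x: "x \<in> V" for J' c x
    using that(1,2)
  proof (induction J' rule: finite_induct)
    case empty
    show ?case
      using R_neg[OF right_add[OF x t.subspace_0[OF W] t.subspace_0[OF W]]] by simp
  next
    case (insert j J')
    have sum_W: "(\<Sum>j\<in>J'. t (c j) (h' j)) \<in> W"
      using insert.prems h' by (intro t.subspace_sum[OF W] t.subspace_scale[OF W]) auto
    have j: "h' j \<in> W"
      using insert.prems h' by auto
    let ?a = "single (x, t (c j) (h' j) + (\<Sum>j\<in>J'. t (c j) (h' j)))"
      and ?b = "single (x, t (c j) (h' j))"
      and ?d = "single (x, \<Sum>j\<in>J'. t (c j) (h' j))"
    have "(?a - ?b - ?d) + (?b - pscale (c j) (single (x, h' j)))
        + (?d - (\<Sum>j\<in>J'. pscale (c j) (single (x, h' j)))) \<in> R"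
      using insert.prems
      by (intro R_add right_add right_scale t.subspace_scale[OF W] j sum_W x insert.IH) blast
    then show ?case
      unfolding sum.insert[OF insert.hyps] regroup .
  qed
  define e where "e x y = (\<Sum>i\<in>I. \<Sum>j\<in>J. pscale (\<phi> i x * \<psi> j y) (single (h i, h' j)))" for x y
  have generator: "single (x, y) - e x y \<in> R" if "x \<in> V" "y \<in> W" for x y
  proof -
    have "(single (x, y) - (\<Sum>i\<in>I. pscale (\<phi> i x) (single (h i, y))))
        + (\<Sum>i\<in>I. pscale (\<phi> i x)
            (single (h i, y) - (\<Sum>j\<in>J. pscale (\<psi> j y) (single (h i, h' j))))) \<in> R"
      using left[OF fin(1) order_refl that(2), of "\<lambda>i. \<phi> i x"]
        right[OF fin(2) order_refl h, of _ "\<lambda>j. \<psi> j y"] \<phi>[OF that(1), symmetric]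
        \<psi>[OF that(2), symmetric]
      by (intro R_add fun_space.subspace_sum[OF R] R_scale) simp_all
    then show ?thesis
      by (simp add: e_def fun_space.scale_right_diff_distrib sum_subtractf
          fun_space.scale_sum_right)
  qed
  have "(\<Sum>z\<in>{z. u z \<noteq> 0}. pscale (u z) (e (fst z) (snd z)))
      = (\<Sum>i\<in>I. \<Sum>j\<in>J. pscale (\<Sum>z\<in>{z. u z \<noteq> 0}. u z * (\<phi> i (fst z) * \<psi> j (snd z)))
          (single (h i, h' j)))"
    unfolding e_def fun_space.scale_sum_right fun_space.scale_sum_left fun_space.scale_scale
    by (subst sum.swap, rule sum.cong[OF refl], rule sum.swap)
  also have "\<dots> = 0"
    using vanish by simp
  finally have zero: "(\<Sum>z\<in>{z. u z \<noteq> 0}. pscale (u z) (e (fst z) (snd z))) = 0" .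
  have "u = (\<Sum>z\<in>{z. u z \<noteq> 0}. pscale (u z) (single z))"
    by (rule free_space_expansion[OF u])
  also have "\<dots> = (\<Sum>z\<in>{z. u z \<noteq> 0}. pscale (u z) (single z - e (fst z) (snd z)))"
    using zero by (simp add: fun_space.scale_right_diff_distrib sum_subtractf)
  also have "\<dots> \<in> R"
  proof (intro fun_space.subspace_sum[OF R] R_scale)
    fix z assume "z \<in> {z. u z \<noteq> 0}"
    then have "z \<in> V \<times> W"
      using u by (auto simp: free_space_def)
    then show "single z - e (fst z) (snd z) \<in> R"
      using generator by auto
  qed
  finally show ?thesis
    unfolding R_def .
qed

text \<open>Under \<open>L[N] \<otimes>\<^sub>L L[N] = L[N \<times> N]\<close>, a formal sum \<open>u\<close> of pairs of functions on \<open>N\<close> becomes a function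
  on \<open>N \<times> N\<close>; this is its value at \<open>(p, q)\<close>. The map \<open>\<eta>\<close> is \<open>id\<close> for sums over \<open>L\<close> and the
  inclusion of \<open>K\<close> for sums over \<open>K\<close>.\<close>

definition tensor_coeff :: "('k::field \<Rightarrow> 'l::field) \<Rightarrow> (('n \<Rightarrow> 'l) \<times> ('n \<Rightarrow> 'l) \<Rightarrow> 'k) \<Rightarrow> 'n \<Rightarrow> 'n \<Rightarrow> 'l"
  where "tensor_coeff \<eta> u p q = (\<Sum>z\<in>{z. u z \<noteq> 0}. \<eta> (u z) * (fst z p * snd z q))"

lemma tensor_coeff_superset:
  assumes "field_hom \<eta>" "finite S" "{z. u z \<noteq> 0} \<subseteq> S"
  shows "tensor_coeff \<eta> u p q = (\<Sum>z\<in>S. \<eta> (u z) * (fst z p * snd z q))"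
  unfolding tensor_coeff_def
  by (rule sum.mono_neutral_left) (use assms in \<open>auto simp: field_hom_simps\<close>)

lemma tensor_coeff_base_change:
  assumes "field_hom \<eta>"
  shows "tensor_coeff id (\<eta> \<circ> u) = tensor_coeff \<eta> u"
  unfolding tensor_coeff_def by (simp add: fun_eq_iff field_hom_simps[OF assms])

lemma tensor_coeff_add:
  assumes "field_hom \<eta>" "u \<in> free_space X" "v \<in> free_space X"
  shows "tensor_coeff \<eta> (u + v) p q = tensor_coeff \<eta> u p q + tensor_coeff \<eta> v p q"
proof -
  let ?S = "{z. u z \<noteq> 0} \<union> {z. v z \<noteq> 0}"
  have S: "finite ?S"
    using assms by (auto simp: free_space_def)
  show ?thesis
    using S by (subst (1 2 3) tensor_coeff_superset[OF assms(1) S])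
      (auto simp: field_hom_simps[OF assms(1)] algebra_simps sum.distrib)
qed

lemma tensor_coeff_scale:
  assumes "field_hom \<eta>" "u \<in> free_space X"
  shows "tensor_coeff \<eta> (pscale c u) p q = \<eta> c * tensor_coeff \<eta> u p q"
proof -
  have S: "finite {z. u z \<noteq> 0}"
    using assms by (auto simp: free_space_def)
  show ?thesis
    by (subst (1 2) tensor_coeff_superset[OF assms(1) S])
      (auto simp: pscale_apply field_hom_simps[OF assms(1)] algebra_simps sum_distrib_left)
qed

lemma tensor_coeff_zero: "tensor_coeff \<eta> 0 p q = 0"
  by (simp add: tensor_coeff_def)

lemma tensor_coeff_diff:
  assumes "field_hom \<eta>" "u \<in> free_space X" "v \<in> free_space X"
  shows "tensor_coeff \<eta> (u - v) p q = tensor_coeff \<eta> u p q - tensor_coeff \<eta> v p q"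
  using tensor_coeff_add[OF assms(1) fun_space.subspace_diff[OF free_space_subspace assms(2,3)]
      assms(3), of p q]
  by simp

lemma tensor_coeff_single:
  assumes "field_hom \<eta>"
  shows "tensor_coeff \<eta> (single (x, y)) p q = x p * y q"
  by (subst tensor_coeff_superset[OF assms, of "{(x, y)}"])
    (auto simp: single_def field_hom_simps[OF assms] split: if_splits)

lemma sum_in_free_space:
  assumes "\<And>i. i \<in> I \<Longrightarrow> z i \<in> X"
  shows "(\<Sum>i\<in>I. pscale (c i) (single (z i))) \<in> free_space X"
  using assms
  by (intro fun_space.subspace_sum fun_space.subspace_scale free_space_subspace single_in_free_space)

lemma tensor_coeff_sum:
  assumes "field_hom \<eta>" and fin: "finite I"
  shows "tensor_coeff \<eta> (\<Sum>i\<in>I. pscale (c i) (single (x i, y i))) p q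
    = (\<Sum>i\<in>I. \<eta> (c i) * (x i p * y i q))"
  using fin
proof (induction I rule: finite_induct)
  case (insert i I)
  have "tensor_coeff \<eta> (pscale (c i) (single (x i, y i))) p q = \<eta> (c i) * (x i p * y i q)"
    by (simp add: tensor_coeff_scale[OF assms(1) single_in_free_space[OF UNIV_I]]
        tensor_coeff_single[OF assms(1)])
  then show ?case
    unfolding sum.insert[OF insert.hyps]
    by (subst tensor_coeff_add[OF assms(1)
          fun_space.subspace_scale[OF free_space_subspace single_in_free_space[OF UNIV_I]]
          sum_in_free_space[OF UNIV_I]])
      (simp only: insert.IH)
qed (simp only: sum.empty tensor_coeff_zero)

text \<open>The form \<open>(x, y) \<mapsto> x p \<cdot> y q\<close> is bilinear, so it respects the relations.\<close>

lemma span_tensor_relations_coeff: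
  fixes \<eta> :: "'k::field \<Rightarrow> 'l::field" and V :: "('n \<Rightarrow> 'l) set"
  defines "s \<equiv> \<lambda>c. pscale (\<eta> c)"
  assumes \<eta>: "field_hom \<eta>" and V: "module.subspace s V"
    and u: "u \<in> fun_space.span (tensor_relations s V s V)"
  shows "u \<in> free_space (V \<times> V)" and "tensor_coeff \<eta> u p q = 0"
proof -
  interpret s: vector_space s
    unfolding s_def by (rule vector_space_pscale[OF \<eta>])
  note V_closed = s.subspace_add[OF V] s.subspace_scale[OF V]
  note free = fun_space.subspace_diff[OF free_space_subspace]
    fun_space.subspace_scale[OF free_space_subspace] single_in_free_space SigmaI
  define Z where "Z = {u \<in> free_space (V \<times> V). tensor_coeff \<eta> u p q = 0}"
  have sub: "fun_space.subspace Z"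
  proof (rule fun_space.subspaceI)
    show "0 \<in> Z"
      by (simp add: Z_def tensor_coeff_zero fun_space.subspace_0[OF free_space_subspace])
    show "u + v \<in> Z" if "u \<in> Z" "v \<in> Z" for u v
      using that tensor_coeff_add[OF \<eta>, of u "V \<times> V" v p q] unfolding Z_def
      by (simp add: fun_space.subspace_add[OF free_space_subspace])
    show "pscale c u \<in> Z" if "u \<in> Z" for c u
      using that tensor_coeff_scale[OF \<eta>, of u "V \<times> V" c p q] unfolding Z_def
      by (simp add: fun_space.subspace_scale[OF free_space_subspace])
  qed
  have free_rel: "tensor_relations s V s V \<subseteq> free_space (V \<times> V)"
    unfolding tensor_relations_def by (auto intro!: free V_closed)
  have single_coeff:
    "tensor_coeff \<eta> (single x - single y - single z) p q
      = tensor_coeff \<eta> (single x) p q - tensor_coeff \<eta> (single y) p q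
        - tensor_coeff \<eta> (single z) p q"
    "tensor_coeff \<eta> (single x - pscale c (single y)) p q
      = tensor_coeff \<eta> (single x) p q - \<eta> c * tensor_coeff \<eta> (single y) p q" for x y z c
    by (simp_all only: tensor_coeff_diff[OF \<eta> free(1) free(3), of _ UNIV _ _ p q]
        tensor_coeff_diff[OF \<eta> free(3) free(2), of _ UNIV _ _ p q]
        tensor_coeff_diff[OF \<eta> free(3) free(3), of _ UNIV _ p q]
        tensor_coeff_scale[OF \<eta> free(3), of _ UNIV] free UNIV_I)
  have zero:
    "tensor_coeff \<eta> (single (x + x', y) - single (x, y) - single (x', y)) p q = 0"
    "tensor_coeff \<eta> (single (x, y + y') - single (x, y) - single (x, y')) p q = 0"
    "tensor_coeff \<eta> (single (s c x, y) - pscale c (single (x, y))) p q = 0"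
    "tensor_coeff \<eta> (single (x, s c y) - pscale c (single (x, y))) p q = 0" for x x' y y' c
    unfolding single_coeff tensor_coeff_single[OF \<eta>]
    by (simp_all add: s_def pscale_apply algebra_simps)
  have "r \<in> Z" if r: "r \<in> tensor_relations s V s V" for r
  proof -
    have "tensor_coeff \<eta> r p q = 0"
      using r zero unfolding tensor_relations_def by blast
    then show ?thesis
      using r free_rel by (auto simp: Z_def)
  qed
  then have "tensor_relations s V s V \<subseteq> Z" ..
  then have "u \<in> Z"
    using u fun_space.span_minimal[OF _ sub] by blast
  then show "u \<in> free_space (V \<times> V)" "tensor_coeff \<eta> u p q = 0"
    by (auto simp: Z_def)
qed

lemma tensor_class_eq_iff:
  "tensor_class s V t W u = tensor_class s V t W v
    \<longleftrightarrow> u - v \<in> fun_space.span (tensor_relations s V t W)"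
proof
  assume "tensor_class s V t W u = tensor_class s V t W v"
  moreover have "u \<in> tensor_class s V t W u"
    by (simp add: tensor_class_def fun_space.span_zero)
  ultimately show "u - v \<in> fun_space.span (tensor_relations s V t W)"
    by (simp add: tensor_class_def)
next
  assume uv: "u - v \<in> fun_space.span (tensor_relations s V t W)"
  show "tensor_class s V t W u = tensor_class s V t W v"
    using fun_space.span_add[OF _ uv] fun_space.span_diff[OF _ uv]
    by (fastforce simp: tensor_class_def)
qed

section \<open>Invariants of a group algebra\<close>

text \<open>The group \<open>N\<close> with its action abstracts a subgroup of \<open>Perm(\<Gamma>)\<close> on which \<open>\<Gamma>\<close> acts by
  conjugation with \<open>\<lambda>(\<Gamma>)\<close>.\<close>

locale galois_descent =
  finite_galois_extension \<iota> + grp: group N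
  for \<iota> :: "'k::field \<Rightarrow> 'l::field" and N :: "('n, 'm) monoid_scheme" (structure) +
  fixes act :: "('l \<Rightarrow> 'l) \<Rightarrow> 'n \<Rightarrow> 'n"
  assumes finite_carrier: "finite (carrier N)"
    and act_hom: "\<sigma> \<in> \<Gamma> \<Longrightarrow> act \<sigma> \<in> hom N N"
    and act_id: "n \<in> carrier N \<Longrightarrow> act id n = n"
    and act_comp: "\<sigma> \<in> \<Gamma> \<Longrightarrow> \<tau> \<in> \<Gamma> \<Longrightarrow> n \<in> carrier N \<Longrightarrow> act (\<sigma> \<circ> \<tau>) n = act \<sigma> (act \<tau> n)"
begin

abbreviation E where "E \<equiv> group_algebra N :: ('l, 'n \<Rightarrow> 'l) hopf_algebra"
abbreviation s where "s \<equiv> \<lambda>c. pscale (\<iota> c) :: ('n \<Rightarrow> 'l) \<Rightarrow> ('n \<Rightarrow> 'l)"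

definition invariants :: "('n \<Rightarrow> 'l) set" where
  "invariants = {f \<in> carrier E. \<forall>\<sigma>\<in>\<Gamma>. \<forall>n\<in>carrier N. f (act \<sigma> n) = \<sigma> (f n)}"

definition H :: "('k, 'n \<Rightarrow> 'l) hopf_algebra" where
  "H = \<lparr>carrier = invariants, monoid.mult = monoid.mult E, one = \<one>\<^bsub>E\<^esub>, scale = s,
     comult = (\<lambda>f. the_inv_into (tensor_product s invariants s invariants)
       (base_change \<iota> E) (comult E f)),
     counit = (\<lambda>f. the_inv \<iota> (counit E f)),
     antipode = antipode E\<rparr>"

lemma H_simps [simp]:
  "carrier H = invariants" "scale H = s" "\<one>\<^bsub>H\<^esub> = \<one>\<^bsub>E\<^esub>" "x \<otimes>\<^bsub>H\<^esub> y = x \<otimes>\<^bsub>E\<^esub> y"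
  "antipode H = antipode E"
  "comult H x = the_inv_into (tensor_product s invariants s invariants) (base_change \<iota> E) (comult E x)"
  by (simp_all add: H_def)

lemma E_simps [simp]:
  "carrier E = group_algebra_carrier N" "scale E = pscale" "\<one>\<^bsub>E\<^esub> = single \<one>"
  "antipode E f n = (if n \<in> carrier N then f (inv n) else 0)"
  by (simp_all add: group_algebra_def)

lemma group_algebra_carrier_iff: "f \<in> group_algebra_carrier N \<longleftrightarrow> (\<forall>n. n \<notin> carrier N \<longrightarrow> f n = 0)"
  by (simp add: group_algebra_carrier_def)

lemma E_mult_apply:
  "(f \<otimes>\<^bsub>E\<^esub> g) x = (if x \<in> carrier N then \<Sum>y\<in>carrier N. f y * g (inv y \<otimes> x) else 0)"
proof (cases "x \<in> carrier N")
  case True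
  have "(\<Sum>(y, z)\<in>{(y, z) \<in> carrier N \<times> carrier N. y \<otimes> z = x}. f y * g z)
      = (\<Sum>y\<in>carrier N. f y * g (inv y \<otimes> x))"
    by (rule sum.reindex_bij_witness[of _ "\<lambda>y. (y, inv y \<otimes> x)" fst])
      (use True in \<open>auto simp: grp.m_assoc[symmetric] grp.inv_solve_left'\<close>)
  then show ?thesis
    using True by (simp add: group_algebra_def)
next
  case False
  then have empty: "{(y, z) \<in> carrier N \<times> carrier N. y \<otimes> z = x} = {}"
    by auto
  show ?thesis
    using False by (simp add: group_algebra_def empty del: mem_Sigma_iff)
qed

lemma act_closed: "\<sigma> \<in> \<Gamma> \<Longrightarrow> n \<in> carrier N \<Longrightarrow> act \<sigma> n \<in> carrier N"
  and act_mult: "\<sigma> \<in> \<Gamma> \<Longrightarrow> m \<in> carrier N \<Longrightarrow> n \<in> carrier N \<Longrightarrow>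
    act \<sigma> (m \<otimes> n) = act \<sigma> m \<otimes> act \<sigma> n"
  using act_hom[of \<sigma>] by (auto simp: hom_def)

lemma act_group_hom: "\<sigma> \<in> \<Gamma> \<Longrightarrow> group_hom N N (act \<sigma>)"
  by (simp add: group_hom_def group_hom_axioms_def act_hom grp.is_group)

lemma act_one: "\<sigma> \<in> \<Gamma> \<Longrightarrow> act \<sigma> \<one> = \<one>"
  and act_inv: "\<sigma> \<in> \<Gamma> \<Longrightarrow> n \<in> carrier N \<Longrightarrow> act \<sigma> (inv n) = inv (act \<sigma> n)"
  by (simp_all add: group_hom.hom_one[OF act_group_hom] group_hom.hom_inv[OF act_group_hom])

lemma act_cancel:
  assumes "\<sigma> \<in> \<Gamma>" "\<tau> \<in> \<Gamma>" "\<sigma> \<circ> \<tau> = id" "n \<in> carrier N"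
  shows "act \<sigma> (act \<tau> n) = n"
  using act_comp[OF assms(1,2,4)] assms(3,4) by (simp add: act_id)

lemma act_inj: "\<sigma> \<in> \<Gamma> \<Longrightarrow> inj_on (act \<sigma>) (carrier N)"
  by (metis act_cancel galois_inverse inj_onI)

lemma act_bij: "\<sigma> \<in> \<Gamma> \<Longrightarrow> bij_betw (act \<sigma>) (carrier N) (carrier N)"
  using act_inj act_closed
  by (intro endo_inj_surj[OF finite_carrier, THEN bij_betw_imageI[rotated]]) auto

lemma invariants_iff:
  "f \<in> invariants \<longleftrightarrow>
    (\<forall>n. n \<notin> carrier N \<longrightarrow> f n = 0) \<and> (\<forall>\<sigma>\<in>\<Gamma>. \<forall>n\<in>carrier N. f (act \<sigma> n) = \<sigma> (f n))"
  by (auto simp: invariants_def group_algebra_carrier_iff)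

lemma invariants_outside: "f \<in> invariants \<Longrightarrow> n \<notin> carrier N \<Longrightarrow> f n = 0"
  and invariants_act: "f \<in> invariants \<Longrightarrow> \<sigma> \<in> \<Gamma> \<Longrightarrow> n \<in> carrier N \<Longrightarrow> f (act \<sigma> n) = \<sigma> (f n)"
  by (simp_all add: invariants_iff)

lemma invariants_subset: "invariants \<subseteq> group_algebra_carrier N"
  by (auto simp: invariants_iff group_algebra_carrier_iff)

sublocale base: vector_space s
  by (rule vector_space_pscale[OF base_field_hom])

lemma invariants_subspace: "base.subspace invariants"
  by (rule base.subspaceI)
    (auto simp: invariants_iff pscale_apply galois_simps galois_fixes_base)

lemma group_algebra_subspace: "fun_space.subspace (group_algebra_carrier N :: ('n \<Rightarrow> 'l) set)"
  by (rule fun_space.subspaceI) (auto simp: group_algebra_carrier_iff pscale_apply)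

text \<open>Going back along the action expresses the value of every invariant at \<open>p\<close> through its value at
  one other point, which is the same for all invariants. Points outside \<open>N\<close> stay where they are.\<close>

lemma invariants_pullback:
  assumes "\<sigma> \<in> \<Gamma>"
  obtains \<pi> where "inj \<pi>" "\<And>f p. f \<in> invariants \<Longrightarrow> f p = \<sigma> (f (\<pi> p))"
proof -
  obtain \<tau> where \<tau>: "\<tau> \<in> \<Gamma>" "\<sigma> \<circ> \<tau> = id" "\<tau> \<circ> \<sigma> = id"
    using galois_inverse[OF assms] by metis
  define \<pi> where "\<pi> p = (if p \<in> carrier N then act \<tau> p else p)" for p
  have "inj \<pi>"
    using act_inj[OF \<tau>(1)] act_closed[OF \<tau>(1)] by (auto simp: inj_def \<pi>_def inj_on_def)
  moreover have "f p = \<sigma> (f (\<pi> p))" if "f \<in> invariants" for f p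
    using invariants_act[OF that assms act_closed[OF \<tau>(1)]] act_cancel[OF assms \<tau>(1,2)]
      invariants_outside[OF that]
    by (auto simp: \<pi>_def galois_simps[OF assms])
  ultimately show ?thesis
    by (rule that)
qed

text \<open>The element \<open>\<Sum>\<^sub>\<sigma> \<sigma>(c) \<cdot> \<sigma>n\<close>, which is the trace of \<open>c \<cdot> n\<close> for the action of \<open>\<Gamma>\<close> on
  \<open>L[N]\<close>.\<close>

definition orbit_sum :: "'l \<Rightarrow> 'n \<Rightarrow> 'n \<Rightarrow> 'l" where
  "orbit_sum c n p = (\<Sum>\<sigma>\<in>\<Gamma>. if act \<sigma> n = p then \<sigma> c else 0)"

lemma orbit_sum_support: "orbit_sum c n p \<noteq> 0 \<Longrightarrow> \<exists>\<sigma>\<in>\<Gamma>. act \<sigma> n = p"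
  unfolding orbit_sum_def by (rule ccontr, erule notE) (rule sum.neutral, auto)

lemma orbit_sum_invariant:
  assumes n: "n \<in> carrier N"
  shows "orbit_sum c n \<in> invariants"
  unfolding invariants_iff
proof (intro conjI allI impI ballI)
  show "orbit_sum c n p = 0" if "p \<notin> carrier N" for p
    using orbit_sum_support[of c n p] act_closed n that by blast
  fix \<tau> p assume \<tau>: "\<tau> \<in> \<Gamma>" and p: "p \<in> carrier N"
  have "orbit_sum c n (act \<tau> p) = (\<Sum>\<sigma>\<in>\<Gamma>. if act (\<tau> \<circ> \<sigma>) n = act \<tau> p then (\<tau> \<circ> \<sigma>) c else 0)"
    unfolding orbit_sum_def
    by (rule galois_reindex[OF \<tau>, of "\<lambda>\<sigma>. if act \<sigma> n = act \<tau> p then \<sigma> c else 0", symmetric])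
  also have "\<dots> = (\<Sum>\<sigma>\<in>\<Gamma>. \<tau> (if act \<sigma> n = p then \<sigma> c else 0))"
    by (intro sum.cong refl)
      (auto simp: act_comp[OF \<tau> _ n] galois_simps[OF \<tau>] n p act_closed
        inj_on_eq_iff[OF act_inj[OF \<tau>]])
  also have "\<dots> = \<tau> (orbit_sum c n p)"
    by (simp add: orbit_sum_def galois_simps(7)[OF \<tau>])
  finally show "orbit_sum c n (act \<tau> p) = \<tau> (orbit_sum c n p)" .
qed

text \<open>The sum over \<open>j\<close> removes the contributions of all \<open>\<sigma> \<noteq> id\<close>. In particular the invariants span
  \<open>L[N]\<close> over \<open>L\<close>.\<close>

lemma orbit_sum_recovers:
  assumes dual: "dual_system m c d" and n: "n \<in> carrier N"
  shows "(\<Sum>j<m. d j * orbit_sum (c j) n p) = single n p"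
proof -
  have "(\<Sum>j<m. d j * orbit_sum (c j) n p)
      = (\<Sum>\<sigma>\<in>\<Gamma>. \<Sum>j<m. d j * (if act \<sigma> n = p then \<sigma> (c j) else 0))"
    unfolding orbit_sum_def sum_distrib_left by (rule sum.swap)
  also have "\<dots> = (\<Sum>\<sigma>\<in>\<Gamma>. if act \<sigma> n = p then \<Sum>j<m. \<sigma> (c j) * d j else 0)"
    by (intro sum.cong refl) (simp add: mult.commute)
  also have "\<dots> = (\<Sum>\<sigma>\<in>\<Gamma>. if \<sigma> = id then single n p else 0)"
    by (intro sum.cong refl, subst dual_system_sum[OF dual])
      (auto simp: single_def act_id n)
  also have "\<dots> = single n p"
    using finite_galois_group id_in_galois by simp
  finally show ?thesis .
qed

lemma group_algebra_expansion:
  assumes "f \<in> group_algebra_carrier N"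
  shows "f p = (\<Sum>n\<in>carrier N. f n * single n p)"
  using assms finite_carrier
  by (cases "p \<in> carrier N")
    (auto simp: group_algebra_carrier_iff single_def if_distrib cong: if_cong)

lemma orbit_sum_expansion:
  assumes dual: "dual_system m c d" and f: "f \<in> group_algebra_carrier N"
  shows "f p = (\<Sum>(n, j)\<in>carrier N \<times> {..<m}. f n * d j * orbit_sum (c j) n p)"
proof -
  have "f p = (\<Sum>n\<in>carrier N. f n * (\<Sum>j<m. d j * orbit_sum (c j) n p))"
    unfolding group_algebra_expansion[OF f, of p]
    by (intro sum.cong refl) (simp add: orbit_sum_recovers[OF dual])
  then show ?thesis
    by (simp add: sum_distrib_left sum.cartesian_product mult.assoc)
qed

text \<open>Averaging applies at each point \<open>p\<close>: for every \<open>\<sigma> \<in> \<Gamma>\<close>, the values of all invariants at \<open>p\<close> are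
  the images under \<open>\<sigma>\<close> of their values at one common point.\<close>

lemma invariants_average:
  assumes e: "trace e = 1" and f: "f \<in> invariants" and I: "\<And>i. i \<in> I \<Longrightarrow> g i \<in> invariants"
    and sum: "\<And>p. f p = (\<Sum>i\<in>I. r i * g i p)"
  shows "f = (\<Sum>i\<in>I. s (trace (e * r i)) (g i))"
proof
  fix p
  have "f p = (\<Sum>i\<in>I. \<iota> (trace (e * r i)) * g i p)"
  proof (rule trace_average[OF e sum])
    fix \<sigma> assume \<sigma>: "\<sigma> \<in> \<Gamma>"
    obtain \<pi> where "\<And>f p. f \<in> invariants \<Longrightarrow> f p = \<sigma> (f (\<pi> p))"
      using invariants_pullback[OF \<sigma>] by metis
    then show "\<exists>p'. f p = \<sigma> (f p') \<and> (\<forall>i\<in>I. g i p = \<sigma> (g i p'))"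
      using f I by blast
  qed
  then show "f p = (\<Sum>i\<in>I. s (trace (e * r i)) (g i)) p"
    by (simp add: sum_fun_apply pscale_apply)
qed

section \<open>The comultiplication of the invariants\<close>

text \<open>The map \<open>H \<otimes>\<^sub>K H \<rightarrow> L[N] \<otimes>\<^sub>L L[N]\<close> is injective: the invariants are generated over \<open>K\<close> by orbit
  sums, with coordinates that are traces of multiples of the coefficients \<open>x n\<close>, and a trace of
  \<open>x n\<close> is a combination of the coefficients of \<open>x\<close> on the orbit of \<open>n\<close>.\<close>

lemma invariants_tensor_kernel:
  assumes u: "u \<in> free_space (invariants \<times> invariants)"
    and zero: "\<And>p q. tensor_coeff \<iota> u p q = 0"
  shows "u \<in> fun_space.span (tensor_relations s invariants s invariants)"
proof -
  obtain e where e: "trace e = 1"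
    by (rule trace_surjective)
  obtain m c d where dual: "dual_system m c d"
    by (rule dual_system_exists)
  define I where "I = carrier N \<times> {..<m}"
  define h where "h i = orbit_sum (c (snd i)) (fst i)" for i
  define \<phi> where "\<phi> i x = trace (e * (x (fst i) * d (snd i)))" for i and x :: "'n \<Rightarrow> 'l"
  have h: "h i \<in> invariants" if "i \<in> I" for i
    using that by (auto simp: I_def h_def intro: orbit_sum_invariant)
  have \<phi>: "x = (\<Sum>i\<in>I. s (\<phi> i x) (h i))" if x: "x \<in> invariants" for x
    unfolding \<phi>_def
  proof (rule invariants_average[OF e x h])
    show "x p = (\<Sum>i\<in>I. x (fst i) * d (snd i) * h i p)" for p
      using orbit_sum_expansion[OF dual, of x p] x invariants_subset
      by (auto simp: I_def h_def case_prod_unfold)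
  qed
  have "(\<Sum>z\<in>{z. u z \<noteq> 0}. u z * (\<phi> i (fst z) * \<phi> k (snd z))) = 0" if ik: "i \<in> I" "k \<in> I" for i k
  proof -
    have *: "(\<Sum>z\<in>{z. u z \<noteq> 0}. \<iota> (u z) *
        (\<sigma> (e * (fst z (fst i) * d (snd i))) * \<tau> (e * (snd z (fst k) * d (snd k))))) = 0"
      if \<sigma>: "\<sigma> \<in> \<Gamma>" and \<tau>: "\<tau> \<in> \<Gamma>" for \<sigma> \<tau>
    proof -
      have "(\<Sum>z\<in>{z. u z \<noteq> 0}. \<iota> (u z) *
          (\<sigma> (e * (fst z (fst i) * d (snd i))) * \<tau> (e * (snd z (fst k) * d (snd k)))))
        = (\<Sum>z\<in>{z. u z \<noteq> 0}. (\<sigma> (e * d (snd i)) * \<tau> (e * d (snd k))) *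
          (\<iota> (u z) * (fst z (act \<sigma> (fst i)) * snd z (act \<tau> (fst k)))))"
      proof (rule sum.cong[OF refl])
        fix z assume "z \<in> {z. u z \<noteq> 0}"
        then have z: "fst z \<in> invariants" "snd z \<in> invariants"
          using u by (auto simp: free_space_def)
        have n: "fst i \<in> carrier N" "fst k \<in> carrier N"
          using ik by (auto simp: I_def)
        show "\<iota> (u z) *
            (\<sigma> (e * (fst z (fst i) * d (snd i))) * \<tau> (e * (snd z (fst k) * d (snd k))))
          = (\<sigma> (e * d (snd i)) * \<tau> (e * d (snd k))) *
            (\<iota> (u z) * (fst z (act \<sigma> (fst i)) * snd z (act \<tau> (fst k))))"
          by (simp only: invariants_act[OF z(1) \<sigma> n(1)] invariants_act[OF z(2) \<tau> n(2)]
              galois_simps(3)[OF \<sigma>] galois_simps(3)[OF \<tau>] mult_ac)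
      qed
      also have "\<dots> = \<sigma> (e * d (snd i)) * \<tau> (e * d (snd k)) *
          tensor_coeff \<iota> u (act \<sigma> (fst i)) (act \<tau> (fst k))"
        by (simp only: tensor_coeff_def sum_distrib_left)
      finally show ?thesis
        by (simp add: zero)
    qed
    have "\<iota> (\<Sum>z\<in>{z. u z \<noteq> 0}. u z * (\<phi> i (fst z) * \<phi> k (snd z)))
      = (\<Sum>z\<in>{z. u z \<noteq> 0}. \<Sum>\<sigma>\<in>\<Gamma>. \<Sum>\<tau>\<in>\<Gamma>. \<iota> (u z) *
          (\<sigma> (e * (fst z (fst i) * d (snd i))) * \<tau> (e * (snd z (fst k) * d (snd k)))))"
      by (simp only: base_simps \<phi>_def base_trace sum_product) (simp only: sum_distrib_left)
    also have "\<dots> = (\<Sum>\<sigma>\<in>\<Gamma>. \<Sum>\<tau>\<in>\<Gamma>. \<Sum>z\<in>{z. u z \<noteq> 0}. \<iota> (u z) *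
          (\<sigma> (e * (fst z (fst i) * d (snd i))) * \<tau> (e * (snd z (fst k) * d (snd k)))))"
      by (subst sum.swap, rule sum.cong[OF refl], rule sum.swap)
    also have "\<dots> = 0"
      by (intro sum.neutral ballI *)
    finally show ?thesis
      by (rule base_simps(6)[THEN iffD1])
  qed
  moreover have "finite I"
    using finite_carrier by (simp add: I_def)
  ultimately show ?thesis
    using h \<phi> u
    by (intro in_span_tensor_relations[OF base.vector_space_axioms base.vector_space_axioms
          invariants_subspace invariants_subspace, where h = h and h' = h and \<phi> = \<phi> and \<psi> = \<phi>
          and I = I and J = I]) auto
qed

lemma group_algebra_tensor_kernel:
  assumes u: "u \<in> free_space (group_algebra_carrier N \<times> group_algebra_carrier N)"
    and zero: "\<And>p q. tensor_coeff id u p q = (0 :: 'l)"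
  shows "u \<in> fun_space.span
    (tensor_relations pscale (group_algebra_carrier N) pscale (group_algebra_carrier N))"
proof -
  have single: "(single n :: 'n \<Rightarrow> 'l) \<in> group_algebra_carrier N" if "n \<in> carrier N" for n
    using that by (auto simp: group_algebra_carrier_iff single_def)
  have expansion: "x = (\<Sum>n\<in>carrier N. pscale (x n) (single n))"
    if "x \<in> group_algebra_carrier N" for x :: "'n \<Rightarrow> 'l"
    by (rule ext) (simp add: sum_fun_apply pscale_apply flip: group_algebra_expansion[OF that])
  have "(\<Sum>z\<in>{z. u z \<noteq> 0}. u z * (fst z p * snd z q)) = 0" for p q
    using zero[of p q] by (simp add: tensor_coeff_def)
  with u single expansion show ?thesis
    by (intro in_span_tensor_relations[OF fun_space.vector_space_axioms
          fun_space.vector_space_axioms group_algebra_subspace group_algebra_subspace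
          finite_carrier finite_carrier, where h = single and h' = single
          and \<phi> = "\<lambda>n x. x n" and \<psi> = "\<lambda>n x. x n"])
qed

lemma group_algebra_class_eq_iff:
  assumes "u \<in> free_space (group_algebra_carrier N \<times> group_algebra_carrier N)"
    and "v \<in> free_space (group_algebra_carrier N \<times> group_algebra_carrier N)"
  shows "hopf_tensor_class E u = hopf_tensor_class E v
    \<longleftrightarrow> (\<forall>p q. tensor_coeff id u p q = (tensor_coeff id v p q :: 'l))"
proof -
  have "tensor_coeff id (u - v) p q = tensor_coeff id u p q - tensor_coeff id v p q" for p q
    using assms by (intro tensor_coeff_diff field_hom_id)
  moreover have "u - v \<in> fun_space.span
      (tensor_relations pscale (group_algebra_carrier N) pscale (group_algebra_carrier N))
    \<longleftrightarrow> (\<forall>p q. tensor_coeff id (u - v) p q = 0)"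
    using group_algebra_tensor_kernel[of "u - v"]
      span_tensor_relations_coeff(2)[OF field_hom_id, of "group_algebra_carrier N" "u - v"]
      fun_space.subspace_diff[OF free_space_subspace assms] group_algebra_subspace
    by (auto simp: id_def)
  ultimately show ?thesis
    by (simp add: tensor_class_eq_iff)
qed

lemma invariants_class_eq_iff:
  assumes "u \<in> free_space (invariants \<times> invariants)" "v \<in> free_space (invariants \<times> invariants)"
  shows "hopf_tensor_class H u = hopf_tensor_class H v
    \<longleftrightarrow> (\<forall>p q. tensor_coeff \<iota> u p q = tensor_coeff \<iota> v p q)"
proof -
  have "tensor_coeff \<iota> (u - v) p q = tensor_coeff \<iota> u p q - tensor_coeff \<iota> v p q" for p q
    using assms by (intro tensor_coeff_diff base_field_hom)
  moreover have "u - v \<in> fun_space.span (tensor_relations s invariants s invariants)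
    \<longleftrightarrow> (\<forall>p q. tensor_coeff \<iota> (u - v) p q = 0)"
    using invariants_tensor_kernel[of "u - v"]
      span_tensor_relations_coeff(2)[OF base_field_hom invariants_subspace, of "u - v"]
      fun_space.subspace_diff[OF free_space_subspace assms]
    by auto
  ultimately show ?thesis
    by (simp add: tensor_class_eq_iff)
qed

lemma free_space_base_change:
  assumes "u \<in> free_space (invariants \<times> invariants)"
  shows "\<iota> \<circ> u \<in> free_space (group_algebra_carrier N \<times> group_algebra_carrier N)"
proof -
  have supp: "{z. (\<iota> \<circ> u) z \<noteq> 0} = {z. u z \<noteq> 0}"
    by (simp add: base_simps)
  have "finite {z. u z \<noteq> 0}" "{z. u z \<noteq> 0} \<subseteq> invariants \<times> invariants"
    using assms by (simp_all add: free_space_def)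
  then show ?thesis
    unfolding free_space_def mem_Collect_eq supp
    using Sigma_mono[OF invariants_subset invariants_subset] by (meson subset_trans)
qed

text \<open>All representatives of one class in \<open>H \<otimes>\<^sub>K H\<close> have the same coefficient function, so
  the choice of the representative \<open>u\<close> is immaterial.\<close>

lemma base_change_class:
  assumes u: "u \<in> free_space (invariants \<times> invariants)"
  shows "base_change \<iota> E (hopf_tensor_class H u) = hopf_tensor_class E (\<iota> \<circ> u)"
proof -
  have "hopf_tensor_class E (\<iota> \<circ> w) = hopf_tensor_class E (\<iota> \<circ> u)"
    if "w \<in> hopf_tensor_class H u" for w
  proof -
    have span: "w - u \<in> fun_space.span (tensor_relations s invariants s invariants)"
      using that by (simp add: tensor_class_def)
    have "w = (w - u) + u"
      by simp
    moreover have "w - u \<in> free_space (invariants \<times> invariants)"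
      by (rule span_tensor_relations_coeff(1)[OF base_field_hom invariants_subspace span])
    ultimately have w: "w \<in> free_space (invariants \<times> invariants)"
      using fun_space.subspace_add[OF free_space_subspace _ u] by metis
    have "hopf_tensor_class H w = hopf_tensor_class H u"
      using span by (simp add: tensor_class_eq_iff)
    then show ?thesis
      using invariants_class_eq_iff[OF w u]
        group_algebra_class_eq_iff[OF free_space_base_change[OF w] free_space_base_change[OF u]]
      by (simp add: tensor_coeff_base_change[OF base_field_hom])
  qed
  moreover have "u \<in> hopf_tensor_class H u"
    by (simp add: tensor_class_def fun_space.span_zero)
  ultimately have "(\<lambda>w. hopf_tensor_class E (\<iota> \<circ> w)) ` hopf_tensor_class H u
      = {hopf_tensor_class E (\<iota> \<circ> u)}"
    by blast
  then show ?thesis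
    by (simp only: base_change_def the_elem_eq)
qed

lemma base_change_inj: "inj_on (base_change \<iota> E) (tensor_product s invariants s invariants)"
proof (rule inj_onI)
  fix x y
  assume "x \<in> tensor_product s invariants s invariants"
    and "y \<in> tensor_product s invariants s invariants"
    and eq: "base_change \<iota> E x = base_change \<iota> E y"
  then obtain u v where u: "u \<in> free_space (invariants \<times> invariants)" "x = hopf_tensor_class H u"
    and v: "v \<in> free_space (invariants \<times> invariants)" "y = hopf_tensor_class H v"
    by (auto simp: tensor_product_def)
  have "hopf_tensor_class E (\<iota> \<circ> u) = hopf_tensor_class E (\<iota> \<circ> v)"
    using eq base_change_class[OF u(1)] base_change_class[OF v(1)] u(2) v(2) by simp
  then show "x = y"
    unfolding u(2) v(2) invariants_class_eq_iff[OF u(1) v(1)]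
    using group_algebra_class_eq_iff[OF free_space_base_change[OF u(1)]
        free_space_base_change[OF v(1)]]
    by (simp add: tensor_coeff_base_change[OF base_field_hom])
qed

lemma comult_E:
  assumes f: "f \<in> group_algebra_carrier N"
  obtains v where "v \<in> free_space (group_algebra_carrier N \<times> group_algebra_carrier N)"
    "comult E f = hopf_tensor_class E v"
    "\<And>p q. tensor_coeff id v p q = (if p = q then f p else 0)"
proof -
  let ?v = "\<Sum>n\<in>carrier N. pscale (f n) (single (single n, single n))
    :: ('n \<Rightarrow> 'l) \<times> ('n \<Rightarrow> 'l) \<Rightarrow> 'l"
  show ?thesis
  proof (rule that[of ?v])
    show "?v \<in> free_space (group_algebra_carrier N \<times> group_algebra_carrier N)"
      by (rule sum_in_free_space) (auto simp: group_algebra_carrier_iff single_def)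
    show "comult E f = hopf_tensor_class E ?v"
      by (simp add: group_algebra_def)
    show "tensor_coeff id ?v p q = (if p = q then f p else 0)" for p q
    proof -
      have "tensor_coeff id ?v p q = (\<Sum>n\<in>carrier N. f n * single n p * single n q)"
        by (simp add: tensor_coeff_sum[OF field_hom_id finite_carrier] mult.assoc)
      also have "\<dots> = (\<Sum>n\<in>carrier N. if p = q then f n * single n p else 0)"
        by (intro sum.cong) (auto simp: single_def)
      also have "\<dots> = (if p = q then f p else 0)"
        by (simp flip: group_algebra_expansion[OF f])
      finally show ?thesis .
    qed
  qed
qed

text \<open>The candidate for the sub-Hopf algebra that belongs to a stable subgroup \<open>S\<close>.\<close>

definition supported :: "'n set \<Rightarrow> ('n \<Rightarrow> 'l) set" where
  "supported S = {f \<in> invariants. \<forall>n. f n \<noteq> 0 \<longrightarrow> n \<in> S}"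

text \<open>The diagonal function with entries \<open>f n\<close> is \<open>\<Gamma>\<close>-equivariant on \<open>N \<times> N\<close> and a combination
  over \<open>L\<close> of products of orbit sums; averaging makes the coefficients lie in \<open>K\<close>.\<close>

lemma comult_lift_exists:
  assumes f: "f \<in> supported S" and S: "S \<subseteq> carrier N" "\<And>\<sigma> n. \<sigma> \<in> \<Gamma> \<Longrightarrow> n \<in> S \<Longrightarrow> act \<sigma> n \<in> S"
  obtains u where "u \<in> free_space (supported S \<times> supported S)"
    "\<And>p q. tensor_coeff \<iota> u p q = (if p = q then f p else 0)"
proof -
  obtain e where e: "trace e = 1"
    by (rule trace_surjective)
  obtain m c d where dual: "dual_system m c d"
    by (rule dual_system_exists)
  \<comment> \<open>Both tensor factors of \<open>n \<otimes> n\<close> are expanded in orbit sums of \<open>n\<close>, with indices \<open>j\<close> and \<open>k\<close>.\<close>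
  define I where "I = S \<times> {..<m} \<times> {..<m}"
  define T where "T n j = orbit_sum (c j) n" for n j
  define r where "r = (\<lambda>(n, j, k). f n * d j * d k)"
  define y where "y = (\<lambda>(n, j, k) (p, q). T n j p * T n k q)"
  define F where "F = (\<lambda>(p, q). if p = q then f p else 0)"
  have f_inv: "f \<in> invariants" and f_supp: "\<And>n. f n \<noteq> 0 \<Longrightarrow> n \<in> S"
    using f by (auto simp: supported_def)
  have fin: "finite S" "finite I"
    using S(1) finite_carrier by (auto simp: I_def intro: finite_subset)
  have T: "T n j \<in> supported S" if "n \<in> S" for n j
    unfolding supported_def mem_Collect_eq T_def
  proof (intro conjI allI impI)
    show "orbit_sum (c j) n \<in> invariants"
      using that S(1) by (intro orbit_sum_invariant) auto
    show "p \<in> S" if "orbit_sum (c j) n p \<noteq> 0" for p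
      using orbit_sum_support[OF that] S(2) \<open>n \<in> S\<close> by blast
  qed
  have F_sum: "F pq = (\<Sum>i\<in>I. r i * y i pq)" for pq
  proof -
    obtain p q where pq: "pq = (p, q)"
      by (cases pq)
    have "(\<Sum>i\<in>I. r i * y i pq)
        = (\<Sum>n\<in>S. \<Sum>j<m. \<Sum>k<m. f n * ((d j * T n j p) * (d k * T n k q)))"
      by (simp add: I_def r_def y_def pq sum.cartesian_product case_prod_unfold mult_ac)
    also have "\<dots> = (\<Sum>n\<in>S. f n * ((\<Sum>j<m. d j * T n j p) * (\<Sum>k<m. d k * T n k q)))"
      by (simp only: sum_product) (simp only: sum_distrib_left)
    also have "\<dots> = (\<Sum>n\<in>S. if p = q then f n * single n p else 0)"
      using S(1) unfolding T_def
      by (intro sum.cong refl) (auto simp: orbit_sum_recovers[OF dual] single_def)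
    also have "\<dots> = F pq"
    proof -
      have "(\<Sum>n\<in>S. f n * single n p) = (\<Sum>n\<in>S. if p = n then f n else 0)"
        by (intro sum.cong) (auto simp: single_def)
      also have "\<dots> = f p"
        using f_supp fin(1) by auto
      finally show ?thesis
        by (auto simp: F_def pq)
    qed
    finally show ?thesis ..
  qed
  define u where "u = (\<Sum>i\<in>I. pscale (trace (e * r i))
    (single (T (fst i) (fst (snd i)), T (fst i) (snd (snd i)))))"
  show ?thesis
  proof (rule that)
    show "u \<in> free_space (supported S \<times> supported S)"
      unfolding u_def by (rule sum_in_free_space) (auto simp: I_def T)
    show "tensor_coeff \<iota> u p q = (if p = q then f p else 0)" for p q
    proof -
      have "F (p, q) = (\<Sum>i\<in>I. \<iota> (trace (e * r i)) * y i (p, q))"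
      proof (rule trace_average[OF e F_sum])
        fix \<sigma> assume \<sigma>: "\<sigma> \<in> \<Gamma>"
        obtain \<pi> where \<pi>: "inj \<pi>" "\<And>f p. f \<in> invariants \<Longrightarrow> f p = \<sigma> (f (\<pi> p))"
          using invariants_pullback[OF \<sigma>] by metis
        have "F (p, q) = \<sigma> (F (\<pi> p, \<pi> q))"
          using \<pi>(2)[OF f_inv, of p] inj_eq[OF \<pi>(1), of p q]
          by (cases "p = q") (simp_all add: F_def galois_simps(4)[OF \<sigma>])
        moreover have "y i (p, q) = \<sigma> (y i (\<pi> p, \<pi> q))" if "i \<in> I" for i
        proof -
          have "T (fst i) j \<in> invariants" for j
            using that T by (auto simp: I_def supported_def)
          then have "T (fst i) j p = \<sigma> (T (fst i) j (\<pi> p))" for j p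
            by (rule \<pi>(2))
          from this[of _ p] this[of _ q] show ?thesis
            by (simp add: y_def case_prod_unfold galois_simps(3)[OF \<sigma>])
        qed
        ultimately show "\<exists>p'. F (p, q) = \<sigma> (F p') \<and> (\<forall>i\<in>I. y i (p, q) = \<sigma> (y i p'))"
          by blast
      qed
      then show ?thesis
        unfolding u_def tensor_coeff_sum[OF base_field_hom fin(2)]
        by (cases "p = q") (simp_all add: F_def y_def case_prod_unfold)
    qed
  qed
qed

lemma supported_all: "supported (carrier N) = invariants"
  using invariants_outside by (auto simp: supported_def)

text \<open>The canonical map to \<open>L[N] \<otimes>\<^sub>L L[N]\<close> is injective and has the diagonal function in its image, so
  \<open>\<Delta> f\<close> is the class of exactly those formal sums that represent this function.\<close>

lemma comult_H_iff:
  assumes f: "f \<in> invariants" and u: "u \<in> free_space (invariants \<times> invariants)"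
  shows "comult H f = hopf_tensor_class H u
    \<longleftrightarrow> (\<forall>p q. tensor_coeff \<iota> u p q = (if p = q then f p else 0))"
proof -
  have diagonal: "comult H f = hopf_tensor_class H w"
    if w: "w \<in> free_space (invariants \<times> invariants)"
      and coeff: "\<And>p q. tensor_coeff \<iota> w p q = (if p = q then f p else 0)" for w
  proof -
    obtain v where v: "v \<in> free_space (group_algebra_carrier N \<times> group_algebra_carrier N)"
      "comult E f = hopf_tensor_class E v"
      "\<And>p q. tensor_coeff id v p q = (if p = q then f p else 0)"
      by (rule comult_E[OF subsetD[OF invariants_subset f]]) (rule that)
    have "hopf_tensor_class E (\<iota> \<circ> w) = hopf_tensor_class E v"
      unfolding group_algebra_class_eq_iff[OF free_space_base_change[OF w] v(1)]
      by (simp add: v(3) coeff tensor_coeff_base_change[OF base_field_hom])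
    then have "base_change \<iota> E (hopf_tensor_class H w) = comult E f"
      by (simp only: base_change_class[OF w] v(2))
    moreover have "hopf_tensor_class H w \<in> tensor_product s invariants s invariants"
      using w by (auto simp: tensor_product_def)
    ultimately show ?thesis
      using base_change_inj by (simp only: H_simps the_inv_into_f_eq)
  qed
  obtain w where w: "w \<in> free_space (invariants \<times> invariants)"
    "\<And>p q. tensor_coeff \<iota> w p q = (if p = q then f p else 0)"
    by (rule comult_lift_exists[of f "carrier N"])
      (use f act_closed that in \<open>auto simp: supported_all\<close>)
  show ?thesis
    unfolding diagonal[OF w] invariants_class_eq_iff[OF w(1) u] by (auto simp: w(2))
qed

section \<open>Sub-Hopf algebras and stable subgroups\<close>

definition stable_subgroup :: "'n set \<Rightarrow> bool" where
  "stable_subgroup S \<longleftrightarrow> subgroup S N \<and> (\<forall>\<sigma>\<in>\<Gamma>. \<forall>n\<in>S. act \<sigma> n \<in> S)"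

definition support :: "('n \<Rightarrow> 'l) set \<Rightarrow> 'n set" where
  "support B = {n. \<exists>f\<in>B. f n \<noteq> 0}"

lemma E_mult_invariant:
  assumes f: "f \<in> invariants" and g: "g \<in> invariants"
  shows "f \<otimes>\<^bsub>E\<^esub> g \<in> invariants"
  unfolding invariants_iff
proof (intro conjI allI impI ballI)
  show "(f \<otimes>\<^bsub>E\<^esub> g) x = 0" if "x \<notin> carrier N" for x
    using that by (simp add: E_mult_apply)
  fix \<sigma> x assume \<sigma>: "\<sigma> \<in> \<Gamma>" and x: "x \<in> carrier N"
  have "(f \<otimes>\<^bsub>E\<^esub> g) (act \<sigma> x) = (\<Sum>y\<in>carrier N. f y * g (inv y \<otimes> act \<sigma> x))"
    by (simp add: E_mult_apply act_closed \<sigma> x)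
  also have "\<dots> = (\<Sum>y\<in>carrier N. f (act \<sigma> y) * g (inv (act \<sigma> y) \<otimes> act \<sigma> x))"
    by (rule sum.reindex_bij_betw[OF act_bij[OF \<sigma>], symmetric])
  also have "\<dots> = (\<Sum>y\<in>carrier N. \<sigma> (f y * g (inv y \<otimes> x)))"
  proof (rule sum.cong[OF refl])
    fix y assume y: "y \<in> carrier N"
    have "inv (act \<sigma> y) \<otimes> act \<sigma> x = act \<sigma> (inv y \<otimes> x)"
      using y x \<sigma> by (simp add: act_mult act_inv)
    then show "f (act \<sigma> y) * g (inv (act \<sigma> y) \<otimes> act \<sigma> x) = \<sigma> (f y * g (inv y \<otimes> x))"
      using y x by (simp add: invariants_act[OF f \<sigma>] invariants_act[OF g \<sigma>] galois_simps(3)[OF \<sigma>])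
  qed
  also have "\<dots> = \<sigma> ((f \<otimes>\<^bsub>E\<^esub> g) x)"
    using x by (simp add: E_mult_apply galois_simps(7)[OF \<sigma>])
  finally show "(f \<otimes>\<^bsub>E\<^esub> g) (act \<sigma> x) = \<sigma> ((f \<otimes>\<^bsub>E\<^esub> g) x)" .
qed

lemma E_mult_support:
  assumes "subgroup S N" and f: "\<And>n. f n \<noteq> 0 \<Longrightarrow> n \<in> S" and g: "\<And>n. g n \<noteq> 0 \<Longrightarrow> n \<in> S"
    and nonzero: "(f \<otimes>\<^bsub>E\<^esub> g) x \<noteq> 0"
  shows "x \<in> S"
proof -
  interpret S: subgroup S N by fact
  have x: "x \<in> carrier N" and "(\<Sum>y\<in>carrier N. f y * g (inv y \<otimes> x)) \<noteq> 0"
    using nonzero by (auto simp: E_mult_apply split: if_splits)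
  then obtain y where y: "y \<in> carrier N" "f y * g (inv y \<otimes> x) \<noteq> 0"
    by (meson sum.not_neutral_contains_not_neutral)
  then have "y \<in> S" "inv y \<otimes> x \<in> S"
    using f g by auto
  then have "y \<otimes> (inv y \<otimes> x) \<in> S"
    by simp
  then show ?thesis
    using x y(1) by (simp add: grp.m_assoc[symmetric])
qed

lemma antipode_invariant:
  assumes "f \<in> invariants"
  shows "antipode E f \<in> invariants"
  using assms by (auto simp: invariants_iff act_closed galois_simps simp flip: act_inv)

lemma single_one_invariant: "single \<one> \<in> invariants"
  unfolding invariants_iff
proof (intro conjI allI impI ballI)
  show "single \<one> n = 0" if "n \<notin> carrier N" for n
    using that by (auto simp: single_def)
  show "single \<one> (act \<sigma> n) = \<sigma> (single \<one> n)" if "\<sigma> \<in> \<Gamma>" "n \<in> carrier N" for \<sigma> n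
    using inj_on_eq_iff[OF act_inj[OF that(1)] that(2) grp.one_closed]
    by (auto simp: single_def act_one galois_simps that)
qed

text \<open>Products and antipodes keep their supports in \<open>S\<close> because \<open>S\<close> is a subgroup. Stability makes the
  orbit sums of elements of \<open>S\<close> available as tensor factors of comultiplications.\<close>

lemma supported_sub_hopf_algebra:
  assumes "stable_subgroup S"
  shows "sub_hopf_algebra (supported S) H"
proof -
  have S: "subgroup S N" "\<And>\<sigma> n. \<sigma> \<in> \<Gamma> \<Longrightarrow> n \<in> S \<Longrightarrow> act \<sigma> n \<in> S"
    using assms by (auto simp: stable_subgroup_def)
  interpret S: subgroup S N by (rule S(1))
  have sub: "supported S \<subseteq> invariants"
    by (auto simp: supported_def)
  have "base.subspace (supported S)"
  proof (rule base.subspaceI)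
    show "0 \<in> supported S"
      using base.subspace_0[OF invariants_subspace] by (simp add: supported_def)
    show "f + g \<in> supported S" if "f \<in> supported S" "g \<in> supported S" for f g
    proof -
      have "f n \<noteq> 0 \<or> g n \<noteq> 0" if "(f + g) n \<noteq> 0" for n
        using that by auto
      then show ?thesis
        using that base.subspace_add[OF invariants_subspace, of f g]
        unfolding supported_def mem_Collect_eq by blast
    qed
    show "s c f \<in> supported S" if "f \<in> supported S" for c f
      using that base.subspace_scale[OF invariants_subspace, of f c]
      by (simp add: supported_def pscale_apply)
  qed
  moreover have "single \<one> \<in> supported S"
    using single_one_invariant by (auto simp: supported_def single_def)
  moreover have "f \<otimes>\<^bsub>E\<^esub> g \<in> supported S" if "f \<in> supported S" "g \<in> supported S" for f g
    using that E_mult_invariant[of f g] E_mult_support[OF S(1), of f g]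
    by (auto simp: supported_def)
  moreover have "comult H f \<in> hopf_tensor_class H ` free_space (supported S \<times> supported S)"
    if f: "f \<in> supported S" for f
  proof -
    obtain u where u: "u \<in> free_space (supported S \<times> supported S)"
      "\<And>p q. tensor_coeff \<iota> u p q = (if p = q then f p else 0)"
      by (rule comult_lift_exists[OF f S.subset]) (use S(2) that in auto)
    have "u \<in> free_space (invariants \<times> invariants)"
      using u(1) Sigma_mono[OF sub sub] by (auto simp: free_space_def)
    then have "comult H f = hopf_tensor_class H u"
      using comult_H_iff[of f u] f sub u(2) by blast
    then show ?thesis
      using u(1) by blast
  qed
  moreover have "antipode E f \<in> supported S" if "f \<in> supported S" for f
  proof -
    have "n \<in> S" if "antipode E f n \<noteq> 0" for n
    proof -
      have n: "n \<in> carrier N" "f (inv n) \<noteq> 0"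
        using that by (auto split: if_splits)
      then have "inv n \<in> S"
        using \<open>f \<in> supported S\<close> by (auto simp: supported_def)
      then show ?thesis
        using S.m_inv_closed[of "inv n"] n(1) by simp
    qed
    then show ?thesis
      using that antipode_invariant sub unfolding supported_def by blast
  qed
  ultimately show ?thesis
    using sub by (simp add: sub_hopf_algebra_def)
qed

text \<open>Since the orbit sums of \<open>n \<in> S\<close> recover \<open>n\<close>, one of them does not vanish at \<open>n\<close>; so different
  stable subgroups give different sub-Hopf algebras.\<close>

lemma support_supported:
  assumes "stable_subgroup S"
  shows "support (supported S) = S"
proof
  show "support (supported S) \<subseteq> S"
    by (auto simp: support_def supported_def)
  show "S \<subseteq> support (supported S)"
  proof
    fix n assume n: "n \<in> S"
    then have nN: "n \<in> carrier N"
      using assms subgroup.subset by (auto simp: stable_subgroup_def)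
    obtain m c d where dual: "dual_system m c d"
      by (rule dual_system_exists)
    have "(\<Sum>j<m. d j * orbit_sum (c j) n n) \<noteq> 0"
      by (simp add: orbit_sum_recovers[OF dual nN])
    then obtain j where "orbit_sum (c j) n n \<noteq> 0"
      by (metis (no_types, lifting) mult_zero_right sum.neutral)
    moreover have "orbit_sum (c j) n \<in> supported S"
      using orbit_sum_invariant[OF nN] orbit_sum_support assms n
      unfolding supported_def stable_subgroup_def by blast
    ultimately show "n \<in> support (supported S)"
      by (auto simp: support_def)
  qed
qed

lemma E_mult_subspace:
  "fun_space.subspace {f. (f \<otimes>\<^bsub>E\<^esub> g) x = 0}"
  "fun_space.subspace {g. (f \<otimes>\<^bsub>E\<^esub> g) x = 0}"
  by (rule fun_space.subspaceI; simp add: E_mult_apply pscale_apply algebra_simps sum.distrib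
      flip: sum_distrib_left split: if_splits)+

context
  fixes B :: "('n \<Rightarrow> 'l) set"
  assumes B: "sub_hopf_algebra B H"
begin

lemma sub_hopf_algebra_facts:
  "B \<subseteq> invariants" "base.subspace B" "single \<one> \<in> B"
  "f \<in> B \<Longrightarrow> g \<in> B \<Longrightarrow> f \<otimes>\<^bsub>E\<^esub> g \<in> B"
  "f \<in> B \<Longrightarrow> comult H f \<in> hopf_tensor_class H ` free_space (B \<times> B)"
  "f \<in> B \<Longrightarrow> antipode E f \<in> B"
  using B by (auto simp: sub_hopf_algebra_def)

text \<open>The group elements are grouplike. Comparing the row of index \<open>n\<close> on both sides of
  \<open>\<Delta> f = \<Sum> y \<otimes> z\<close> with \<open>y, z \<in> B\<close> gives \<open>f n \<cdot> n = \<Sum> y n \<cdot> z\<close>: the \<open>L\<close>-span of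
  \<open>B\<close> contains the group elements that occur in \<open>B\<close>.\<close>

lemma single_in_span:
  assumes "n \<in> support B"
  shows "single n \<in> fun_space.span B"
proof -
  obtain f where f: "f \<in> B" "f n \<noteq> 0"
    using assms by (auto simp: support_def)
  obtain u where u: "u \<in> free_space (B \<times> B)" "comult H f = hopf_tensor_class H u"
    using sub_hopf_algebra_facts(5)[OF f(1)] by blast
  have "u \<in> free_space (invariants \<times> invariants)"
    using u(1) Sigma_mono[OF sub_hopf_algebra_facts(1) sub_hopf_algebra_facts(1)]
    by (auto simp: free_space_def)
  then have coeff: "tensor_coeff \<iota> u p q = (if p = q then f p else 0)" for p q
    using comult_H_iff[of f u] u(2) f(1) sub_hopf_algebra_facts(1) by blast
  have "single n = (\<Sum>z\<in>{z. u z \<noteq> 0}. pscale (\<iota> (u z) * fst z n / f n) (snd z))"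
  proof
    fix q
    have "single n q = tensor_coeff \<iota> u n q / f n"
      using f(2) by (auto simp: coeff single_def)
    then show "single n q = (\<Sum>z\<in>{z. u z \<noteq> 0}. pscale (\<iota> (u z) * fst z n / f n) (snd z)) q"
      by (simp add: tensor_coeff_def sum_fun_apply pscale_apply sum_divide_distrib mult_ac)
  qed
  also have "\<dots> \<in> fun_space.span B"
    using u(1) by (intro fun_space.span_sum fun_space.span_scale fun_space.span_base)
      (auto simp: free_space_def)
  finally show ?thesis .
qed

text \<open>Averaging makes the coefficients of an \<open>L\<close>-combination of elements of \<open>B\<close> lie in \<open>K\<close>, and \<open>B\<close> is a
  \<open>K\<close>-subspace.\<close>

lemma span_invariants:
  assumes "f \<in> fun_space.span B" and f: "f \<in> invariants"
  shows "f \<in> B"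
proof -
  obtain t r where t: "finite t" "t \<subseteq> B" "f = (\<Sum>a\<in>t. pscale (r a) a)"
    using assms(1) by (auto simp: fun_space.span_explicit)
  obtain e where e: "trace e = 1"
    by (rule trace_surjective)
  have "f = (\<Sum>a\<in>t. s (trace (e * r a)) a)"
  proof (rule invariants_average[OF e f])
    show "a \<in> invariants" if "a \<in> t" for a
      using that t(2) sub_hopf_algebra_facts(1) by blast
    show "f p = (\<Sum>a\<in>t. r a * a p)" for p
      by (simp add: t(3) sum_fun_apply pscale_apply)
  qed
  also have "\<dots> \<in> B"
    using t(2) sub_hopf_algebra_facts(2) by (intro base.subspace_sum base.subspace_scale) auto
  finally show ?thesis .
qed

lemma sub_hopf_algebra_eq_supported: "B = supported (support B)"
proof
  show "B \<subseteq> supported (support B)"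
    using sub_hopf_algebra_facts(1) by (auto simp: supported_def support_def)
  show "supported (support B) \<subseteq> B"
  proof
    fix f assume f: "f \<in> supported (support B)"
    have "f = (\<Sum>n\<in>carrier N. pscale (f n) (single n))"
      using f invariants_subset group_algebra_expansion[of f]
      by (intro ext) (auto simp: supported_def sum_fun_apply pscale_apply)
    also have "\<dots> \<in> fun_space.span B"
    proof (rule fun_space.span_sum)
      show "pscale (f n) (single n) \<in> fun_space.span B" for n
        using f single_in_span[of n]
        by (cases "f n = 0") (auto simp: supported_def fun_space.span_zero intro: fun_space.span_scale)
    qed
    finally show "f \<in> B"
      using f span_invariants by (simp add: supported_def)
  qed
qed

text \<open>If every product of two elements of \<open>B\<close> vanished at the group element \<open>mn\<close>, then so would every
  product of two elements of the \<open>L\<close>-span of \<open>B\<close>; but the product of \<open>m\<close> and \<open>n\<close> in \<open>L[N]\<close> does not.\<close>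

lemma support_mult_closed:
  assumes "m \<in> support B" "n \<in> support B"
  shows "m \<otimes> n \<in> support B"
proof (rule ccontr)
  assume "m \<otimes> n \<notin> support B"
  then have BB: "(f \<otimes>\<^bsub>E\<^esub> g) (m \<otimes> n) = 0" if "f \<in> B" "g \<in> B" for f g
    using sub_hopf_algebra_facts(4)[OF that] by (auto simp: support_def)
  have "(f \<otimes>\<^bsub>E\<^esub> single n) (m \<otimes> n) = 0" if "f \<in> B" for f
    using single_in_span[OF assms(2)] E_mult_subspace(2) BB[OF that]
    by (rule fun_space.span_induct)
  then have zero: "(single m \<otimes>\<^bsub>E\<^esub> single n) (m \<otimes> n) = 0"
    by (rule fun_space.span_induct[OF single_in_span[OF assms(1)] E_mult_subspace(1)])
  have mn: "m \<in> carrier N" "n \<in> carrier N"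
    using assms sub_hopf_algebra_facts(1) invariants_outside by (auto simp: support_def)
  have "(single m \<otimes>\<^bsub>E\<^esub> single n) (m \<otimes> n)
      = (\<Sum>y\<in>carrier N. if y = m then single n (inv m \<otimes> (m \<otimes> n)) else 0)"
    using mn by (auto simp: E_mult_apply single_def intro!: sum.cong)
  also have "\<dots> = 1"
    using mn finite_carrier by (simp add: grp.m_assoc[symmetric])
  finally show False
    using zero by simp
qed

lemma support_stable_subgroup: "stable_subgroup (support B)"
  unfolding stable_subgroup_def
proof (intro conjI ballI)
  have supp_N: "support B \<subseteq> carrier N"
    using sub_hopf_algebra_facts(1) invariants_outside by (auto simp: support_def)
  show "subgroup (support B) N"
  proof (rule subgroup.intro[OF supp_N])
    show "m \<otimes> n \<in> support B" if "m \<in> support B" "n \<in> support B" for m n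
      using that by (rule support_mult_closed)
    show "\<one> \<in> support B"
      using sub_hopf_algebra_facts(3) by (auto simp: support_def intro!: bexI[of _ "single \<one>"])
    show "inv n \<in> support B" if n: "n \<in> support B" for n
    proof -
      obtain f where f: "f \<in> B" "f n \<noteq> 0"
        using n by (auto simp: support_def)
      then have "antipode E f (inv n) \<noteq> 0"
        using n supp_N by auto
      then show ?thesis
        using sub_hopf_algebra_facts(6)[OF f(1)] by (auto simp: support_def simp del: E_simps)
    qed
  qed
  fix \<sigma> n assume \<sigma>: "\<sigma> \<in> \<Gamma>" and n: "n \<in> support B"
  obtain f where f: "f \<in> B" "f n \<noteq> 0"
    using n by (auto simp: support_def)
  have "f (act \<sigma> n) = \<sigma> (f n)"
    using f(1) sub_hopf_algebra_facts(1) supp_N n \<sigma> by (intro invariants_act) auto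
  then have "f (act \<sigma> n) \<noteq> 0"
    using f(2) by (simp add: galois_simps(6)[OF \<sigma>])
  then show "act \<sigma> n \<in> support B"
    using f(1) by (auto simp: support_def)
qed

end

theorem bij_betw_supported:
  "bij_betw supported {S. stable_subgroup S} {B. sub_hopf_algebra B H}"
  by (rule bij_betw_byWitness[of _ support])
    (auto simp: support_supported supported_sub_hopf_algebra support_stable_subgroup
      simp flip: sub_hopf_algebra_eq_supported)

end

section \<open>Regular subgroups normalized by the Galois group\<close>

lemma BijGroup_apply:
  assumes "p \<in> carrier (BijGroup X)" "q \<in> carrier (BijGroup X)" "x \<in> X"
  shows "(p \<otimes>\<^bsub>BijGroup X\<^esub> q) x = p (q x)"
  using assms by (simp add: BijGroup_def compose_def)

lemma BijGroup_eqI: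
  assumes "p \<in> carrier (BijGroup X)" "q \<in> carrier (BijGroup X)" "\<And>x. x \<in> X \<Longrightarrow> p x = q x"
  shows "p = q"
  using assms by (auto simp: BijGroup_def intro!: extensionalityI[of p X] dest: Bij_imp_extensional)

lemma finite_BijGroup:
  assumes "finite X"
  shows "finite (carrier (BijGroup X))"
proof -
  have "carrier (BijGroup X) \<subseteq> PiE X (\<lambda>_. X)"
    by (auto simp: BijGroup_def PiE_def Bij_imp_extensional dest: Bij_imp_funcset)
  then show ?thesis
    using assms finite_PiE finite_subset by metis
qed

context group
begin

lemma left_reg_apply: "h \<in> carrier G \<Longrightarrow> left_reg G g h = g \<otimes> h"
  by (simp add: left_reg_def)

lemma left_reg_closed: "g \<in> carrier G \<Longrightarrow> left_reg G g \<in> carrier (BijGroup (carrier G))"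
  unfolding BijGroup_def Bij_def
  by (auto simp: left_reg_def m_assoc[symmetric]
      intro!: bij_betw_byWitness[of _ "\<lambda>h. inv g \<otimes> h"])

lemma left_reg_mult:
  assumes "g \<in> carrier G" "h \<in> carrier G"
  shows "left_reg G (g \<otimes> h) = left_reg G g \<otimes>\<^bsub>BijGroup (carrier G)\<^esub> left_reg G h"
  using assms left_reg_closed group.is_monoid[OF group_BijGroup, of "carrier G"]
  by (intro BijGroup_eqI[of _ "carrier G"])
    (auto simp: BijGroup_apply left_reg_apply m_assoc intro!: monoid.m_closed)

lemma left_reg_hom: "left_reg G \<in> hom G (BijGroup (carrier G))"
  by (simp add: hom_def left_reg_closed left_reg_mult)

lemma left_reg_inj: "inj_on (left_reg G) (carrier G)"
  by (rule inj_onI) (metis left_reg_apply one_closed r_one)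

end

definition galois_conjugate ::
    "('k::field \<Rightarrow> 'l::field) \<Rightarrow> ('l \<Rightarrow> 'l) \<Rightarrow> (('l \<Rightarrow> 'l) \<Rightarrow> ('l \<Rightarrow> 'l)) \<Rightarrow> (('l \<Rightarrow> 'l) \<Rightarrow> ('l \<Rightarrow> 'l))"
  where "galois_conjugate \<iota> \<sigma> n =
    left_reg (galois_group \<iota>) \<sigma> \<otimes>\<^bsub>BijGroup (carrier (galois_group \<iota>))\<^esub> n
      \<otimes>\<^bsub>BijGroup (carrier (galois_group \<iota>))\<^esub>
      inv\<^bsub>BijGroup (carrier (galois_group \<iota>))\<^esub> (left_reg (galois_group \<iota>) \<sigma>)"

text \<open>Conjugation by \<open>\<lambda>(\<Gamma>)\<close> is an action of \<open>\<Gamma>\<close> on \<open>N\<close> by automorphisms, and the Hopf algebra that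
  Greither and Pareigis attach to \<open>N\<close> is the algebra of invariants for this action.\<close>

locale greither_pareigis = finite_galois_extension \<iota>
  for \<iota> :: "'k::field \<Rightarrow> 'l::field" +
  fixes N :: "(('l \<Rightarrow> 'l) \<Rightarrow> ('l \<Rightarrow> 'l)) set"
  assumes N_subgroup: "subgroup N (BijGroup \<Gamma>)"
    and N_normalized: "\<sigma> \<in> \<Gamma> \<Longrightarrow> n \<in> N \<Longrightarrow> galois_conjugate \<iota> \<sigma> n \<in> N"
begin

abbreviation Q where "Q \<equiv> BijGroup \<Gamma>"
abbreviation l where "l \<equiv> left_reg (galois_group \<iota>)"

sublocale Q: group Q
  by (rule group_BijGroup)

lemma N_subset: "N \<subseteq> carrier Q"
  by (rule subgroup.subset[OF N_subgroup])

lemma conjugate_mult: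
  assumes "\<sigma> \<in> \<Gamma>" "m \<in> carrier Q" "n \<in> carrier Q"
  shows "galois_conjugate \<iota> \<sigma> (m \<otimes>\<^bsub>Q\<^esub> n)
    = galois_conjugate \<iota> \<sigma> m \<otimes>\<^bsub>Q\<^esub> galois_conjugate \<iota> \<sigma> n"
proof -
  have l: "l \<sigma> \<in> carrier Q"
    by (rule gal.left_reg_closed[OF assms(1)])
  have "inv\<^bsub>Q\<^esub> l \<sigma> \<otimes>\<^bsub>Q\<^esub> (l \<sigma> \<otimes>\<^bsub>Q\<^esub> x) = x" if "x \<in> carrier Q" for x
    using l that by (simp add: Q.m_assoc[symmetric])
  then show ?thesis
    using l assms by (simp add: galois_conjugate_def Q.m_assoc)
qed

lemma conjugate_id: "n \<in> carrier Q \<Longrightarrow> galois_conjugate \<iota> id n = n"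
proof -
  have "l id = \<one>\<^bsub>Q\<^esub>"
    using gal.left_reg_hom gal.is_group Q.is_group
    by (metis galois_one group_hom.hom_one group_hom.intro group_hom_axioms.intro)
  then show "n \<in> carrier Q \<Longrightarrow> galois_conjugate \<iota> id n = n"
    by (simp add: galois_conjugate_def)
qed

lemma conjugate_comp:
  assumes "\<sigma> \<in> \<Gamma>" "\<tau> \<in> \<Gamma>" "n \<in> carrier Q"
  shows "galois_conjugate \<iota> (\<sigma> \<circ> \<tau>) n = galois_conjugate \<iota> \<sigma> (galois_conjugate \<iota> \<tau> n)"
  using gal.left_reg_mult[OF assms(1,2)] gal.left_reg_closed[OF assms(1)]
    gal.left_reg_closed[OF assms(2)] assms(3)
  by (simp add: galois_conjugate_def galois_mult Q.inv_mult_group Q.m_assoc)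

sublocale galois_descent \<iota> "perm_subgroup \<iota> N" "galois_conjugate \<iota>"
proof (intro galois_descent.intro galois_descent_axioms.intro)
  show "finite_galois_extension \<iota>"
    by (rule finite_galois_extension_axioms)
  show "group (perm_subgroup \<iota> N)"
    unfolding perm_subgroup_def by (rule Q.subgroup_imp_group[OF N_subgroup])
  show "finite (carrier (perm_subgroup \<iota> N))"
    using finite_BijGroup[OF finite_galois_group] N_subset finite_subset
    by (auto simp: perm_subgroup_def)
  show "galois_conjugate \<iota> \<sigma> \<in> hom (perm_subgroup \<iota> N) (perm_subgroup \<iota> N)" if "\<sigma> \<in> \<Gamma>" for \<sigma>
    using N_normalized[OF that] conjugate_mult[OF that] N_subset
    by (auto simp: hom_def perm_subgroup_def subset_iff)
  show "galois_conjugate \<iota> id n = n" if "n \<in> carrier (perm_subgroup \<iota> N)" for n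
    using that N_subset conjugate_id by (auto simp: perm_subgroup_def)
  show "galois_conjugate \<iota> (\<sigma> \<circ> \<tau>) n = galois_conjugate \<iota> \<sigma> (galois_conjugate \<iota> \<tau> n)"
    if "\<sigma> \<in> \<Gamma>" "\<tau> \<in> \<Gamma>" "n \<in> carrier (perm_subgroup \<iota> N)" for \<sigma> \<tau> n
    using that N_subset conjugate_comp by (auto simp: perm_subgroup_def)
qed

lemma carrier_perm_subgroup [simp]: "carrier (perm_subgroup \<iota> N) = N"
  by (simp add: perm_subgroup_def)

lemma galois_action_eq:
  assumes "\<sigma> \<in> \<Gamma>" "\<tau> \<in> \<Gamma>" "\<sigma> \<circ> \<tau> = id"
  shows "galois_action \<iota> N \<sigma> f n = (if n \<in> N then \<sigma> (f (galois_conjugate \<iota> \<tau> n)) else 0)"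
proof -
  have "l \<sigma> \<otimes>\<^bsub>Q\<^esub> l \<tau> = l (\<sigma> \<circ> \<tau>)"
    using gal.left_reg_mult[OF assms(1,2)] by (simp add: galois_mult)
  also have "\<dots> = \<one>\<^bsub>Q\<^esub>"
    using gal.left_reg_hom gal.is_group Q.is_group assms(3)
    by (metis galois_one group_hom.hom_one group_hom.intro group_hom_axioms.intro)
  finally have "l \<tau> = inv\<^bsub>Q\<^esub> l \<sigma>"
    using Q.inv_unique'[OF gal.left_reg_closed[OF assms(1)] gal.left_reg_closed[OF assms(2)]]
      Q.inv_comm gal.left_reg_closed assms(1,2) by metis
  then show ?thesis
    using gal.left_reg_closed[OF assms(1)]
    by (simp add: galois_action_def Let_def galois_conjugate_def)
qed

lemma fixed_ring_eq_invariants: "fixed_ring \<iota> N = invariants"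
proof (rule Set.set_eqI)
  fix f
  have "(\<forall>\<sigma>\<in>\<Gamma>. galois_action \<iota> N \<sigma> f = f)
      \<longleftrightarrow> (\<forall>\<sigma>\<in>\<Gamma>. \<forall>n\<in>N. f (galois_conjugate \<iota> \<sigma> n) = \<sigma> (f n))"
    if zero: "\<And>n. n \<notin> N \<Longrightarrow> f n = 0"
  proof (intro iffI ballI)
    fix \<sigma> n assume fixed: "\<forall>\<sigma>\<in>\<Gamma>. galois_action \<iota> N \<sigma> f = f" and \<sigma>: "\<sigma> \<in> \<Gamma>" and n: "n \<in> N"
    obtain \<tau> where \<tau>: "\<tau> \<in> \<Gamma>" "\<sigma> \<circ> \<tau> = id" "\<tau> \<circ> \<sigma> = id"
      using galois_inverse[OF \<sigma>] by metis
    have "f (galois_conjugate \<iota> \<sigma> n) = galois_action \<iota> N \<sigma> f (galois_conjugate \<iota> \<sigma> n)"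
      using fixed \<sigma> by simp
    also have "\<dots> = \<sigma> (f n)"
      using n N_normalized[OF \<sigma>] act_cancel[OF \<tau>(1) \<sigma> \<tau>(3)]
      by (simp add: galois_action_eq[OF \<sigma> \<tau>(1,2)])
    finally show "f (galois_conjugate \<iota> \<sigma> n) = \<sigma> (f n)" .
  next
    fix \<sigma> assume equi: "\<forall>\<sigma>\<in>\<Gamma>. \<forall>n\<in>N. f (galois_conjugate \<iota> \<sigma> n) = \<sigma> (f n)" and \<sigma>: "\<sigma> \<in> \<Gamma>"
    obtain \<tau> where \<tau>: "\<tau> \<in> \<Gamma>" "\<sigma> \<circ> \<tau> = id" "\<tau> \<circ> \<sigma> = id"
      using galois_inverse[OF \<sigma>] by metis
    show "galois_action \<iota> N \<sigma> f = f"
    proof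
      fix n
      show "galois_action \<iota> N \<sigma> f n = f n"
      proof (cases "n \<in> N")
        case True
        then have "\<sigma> (f (galois_conjugate \<iota> \<tau> n)) = \<sigma> (\<tau> (f n))"
          using equi \<tau>(1) by simp
        then show ?thesis
          using True \<tau>(2) by (simp add: galois_action_eq[OF \<sigma> \<tau>(1,2)] fun_eq_iff)
      qed (simp add: galois_action_eq[OF \<sigma> \<tau>(1,2)] zero)
    qed
  qed
  then show "f \<in> fixed_ring \<iota> N \<longleftrightarrow> f \<in> invariants"
    unfolding fixed_ring_def invariants_def by (auto simp: group_algebra_carrier_iff)
qed

lemma descent_hopf_algebra_eq: "descent_hopf_algebra \<iota> N = H"
  by (simp add: descent_hopf_algebra_def Let_def H_def fixed_ring_eq_invariants)

lemma stable_subgroup_iff: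
  "stable_subgroup S \<longleftrightarrow>
    subgroup S Q \<and> S \<subseteq> N \<and> (\<forall>\<sigma>\<in>\<Gamma>. \<forall>n\<in>S. galois_conjugate \<iota> \<sigma> n \<in> S)"
proof -
  have "subgroup S (perm_subgroup \<iota> N) \<longleftrightarrow> subgroup S Q \<and> S \<subseteq> N"
    using Q.incl_subgroup[OF N_subgroup, of S] Q.subgroup_incl[OF _ N_subgroup, of S]
      subgroup.subset[of S "perm_subgroup \<iota> N"]
    by (auto simp: perm_subgroup_def)
  then show ?thesis
    by (auto simp: stable_subgroup_def)
qed

end

section \<open>Skew left braces\<close>

context skew_left_brace
begin

text \<open>Evaluated at \<open>x\<close>, the identity \<open>\<lambda>\<^sub>\<circ>(k) \<lambda>\<^sub>\<star>(g) = \<lambda>\<^sub>\<star>((k \<circ> g) \<star> k\<^sup>-\<^sup>1) \<lambda>\<^sub>\<circ>(k)\<close> is the brace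
  identity for \<open>k \<circ> (g \<star> x)\<close>.\<close>

lemma conjugate_left_reg:
  assumes k: "k \<in> carrier A" and g: "g \<in> carrier A"
  shows "left_reg C k \<otimes>\<^bsub>BijGroup (carrier A)\<^esub> left_reg A g
      \<otimes>\<^bsub>BijGroup (carrier A)\<^esub> inv\<^bsub>BijGroup (carrier A)\<^esub> (left_reg C k)
    = left_reg A ((k \<otimes>\<^bsub>C\<^esub> g) \<otimes>\<^bsub>A\<^esub> inv\<^bsub>A\<^esub> k)"
proof -
  interpret P: group "BijGroup (carrier A)"
    by (rule group_BijGroup)
  let ?h = "(k \<otimes>\<^bsub>C\<^esub> g) \<otimes>\<^bsub>A\<^esub> inv\<^bsub>A\<^esub> k"
  have closed: "x \<otimes>\<^bsub>C\<^esub> y \<in> carrier A" if "x \<in> carrier A" "y \<in> carrier A" for x y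
    using that circ.m_closed by (simp add: carrier_eq)
  have h: "?h \<in> carrier A"
    using k g closed by simp
  have lk: "left_reg C k \<in> carrier (BijGroup (carrier A))"
    using circ.left_reg_closed k by (simp add: carrier_eq)
  have "left_reg C k \<otimes>\<^bsub>BijGroup (carrier A)\<^esub> left_reg A g
      = left_reg A ?h \<otimes>\<^bsub>BijGroup (carrier A)\<^esub> left_reg C k"
  proof (rule BijGroup_eqI[of _ "carrier A"])
    fix x assume x: "x \<in> carrier A"
    show "(left_reg C k \<otimes>\<^bsub>BijGroup (carrier A)\<^esub> left_reg A g) x
        = (left_reg A ?h \<otimes>\<^bsub>BijGroup (carrier A)\<^esub> left_reg C k) x"
      using x k g closed lk add.left_reg_closed h brace[OF k g x]
      by (simp add: BijGroup_apply add.left_reg_apply circ.left_reg_apply carrier_eq)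
  qed (use lk add.left_reg_closed h g in simp_all)
  then show ?thesis
    using lk add.left_reg_closed[OF h] by (simp add: P.m_assoc)
qed

lemma circ_stable_subgroup_iff:
  "circ_stable_subgroup A C G' \<longleftrightarrow> subgroup G' A \<and>
    (\<forall>k\<in>carrier A. \<forall>g\<in>G'. (k \<otimes>\<^bsub>C\<^esub> g) \<otimes>\<^bsub>A\<^esub> inv\<^bsub>A\<^esub> k \<in> G')"
proof (cases "subgroup G' A")
  case True
  have closed: "(k \<otimes>\<^bsub>C\<^esub> g) \<otimes>\<^bsub>A\<^esub> inv\<^bsub>A\<^esub> k \<in> carrier A" if "k \<in> carrier A" "g \<in> carrier A" for k g
    using that circ.m_closed by (simp add: carrier_eq)
  show ?thesis
    using True subgroup.subset[OF True] closed
    by (auto simp: circ_stable_subgroup_def Let_def conjugate_left_reg subset_iff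
        inj_on_image_mem_iff[OF add.left_reg_inj])
qed (simp add: circ_stable_subgroup_def)

end

lemma transport_BijGroup:
  assumes a: "bij_betw a X Y" and b: "\<And>x. x \<in> X \<Longrightarrow> b (a x) = x"
  defines "\<Psi> \<equiv> \<lambda>p. compose Y a (compose Y p b)"
  shows "\<Psi> \<in> hom (BijGroup X) (BijGroup Y)" and "inj_on \<Psi> (carrier (BijGroup X))"
proof -
  have bY: "b y \<in> X" "a (b y) = y" if "y \<in> Y" for y
    using that a b by (auto simp: bij_betw_def)
  have aX: "a x \<in> Y" if "x \<in> X" for x
    using that a by (auto simp: bij_betw_def)
  have \<Psi>_apply: "\<Psi> p y = a (p (b y))" if "y \<in> Y" for p y
    using that by (simp add: \<Psi>_def compose_def)
  have b_bij: "bij_betw b Y X"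
    by (rule bij_betw_byWitness[of _ a]) (use aX bY b in auto)
  have closed: "\<Psi> p \<in> carrier (BijGroup Y)" if "p \<in> carrier (BijGroup X)" for p
  proof -
    have "bij_betw (a \<circ> (p \<circ> b)) Y Y"
      using that by (intro bij_betw_trans[OF _ a] bij_betw_trans[OF b_bij])
        (simp add: BijGroup_def Bij_def)
    then have "bij_betw (\<Psi> p) Y Y"
      by (rule bij_betw_cong[THEN iffD1, rotated]) (simp add: \<Psi>_apply)
    then show ?thesis
      by (simp add: BijGroup_def Bij_def \<Psi>_def)
  qed
  have maps: "p x \<in> X" if "p \<in> carrier (BijGroup X)" "x \<in> X" for p x
    using that Bij_imp_funcset by (fastforce simp: BijGroup_def)
  interpret X: group "BijGroup X" by (rule group_BijGroup)
  interpret Y: group "BijGroup Y" by (rule group_BijGroup)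
  have "\<Psi> (p \<otimes>\<^bsub>BijGroup X\<^esub> q) = \<Psi> p \<otimes>\<^bsub>BijGroup Y\<^esub> \<Psi> q"
    if pq: "p \<in> carrier (BijGroup X)" "q \<in> carrier (BijGroup X)" for p q
  proof (rule BijGroup_eqI[of _ Y])
    show "\<Psi> (p \<otimes>\<^bsub>BijGroup X\<^esub> q) y = (\<Psi> p \<otimes>\<^bsub>BijGroup Y\<^esub> \<Psi> q) y" if "y \<in> Y" for y
      using that pq by (simp add: \<Psi>_apply BijGroup_apply closed bY(1) aX maps b)
  qed (use pq closed in auto)
  then show "\<Psi> \<in> hom (BijGroup X) (BijGroup Y)"
    by (simp add: hom_def closed)
  show "inj_on \<Psi> (carrier (BijGroup X))"
  proof (rule inj_onI)
    fix p q assume pq: "p \<in> carrier (BijGroup X)" "q \<in> carrier (BijGroup X)" "\<Psi> p = \<Psi> q"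
    show "p = q"
    proof (rule BijGroup_eqI[OF pq(1,2)])
      fix x assume x: "x \<in> X"
      have "a (p x) = a (q x)"
        using fun_cong[OF pq(3), of "a x"] by (simp add: \<Psi>_apply aX b x)
      then show "p x = q x"
        using a pq(1,2) x maps by (metis bij_betw_def inj_onD)
    qed
  qed
qed

text \<open>Conjugation of \<open>\<alpha>(g)\<close> by \<open>\<lambda>(\<sigma>)\<close> corresponds under \<open>a\<close> to conjugation of \<open>\<lambda>\<^sub>\<star>(g)\<close> by \<open>\<lambda>\<^sub>\<circ>(k)\<close> with
  \<open>k = a\<^sup>-\<^sup>1(\<sigma>)\<close>. Therefore \<open>N = \<alpha>(G)\<close> is normalized by \<open>\<lambda>(\<Gamma>)\<close>, and \<open>G' \<mapsto> \<alpha>(G')\<close> identifies the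
  \<open>\<circ>\<close>-stable subgroups with the stable subgroups of \<open>N\<close>, hence with the sub-Hopf algebras.\<close>

theorem theorem4p3:
  fixes A :: "('g, 'm) monoid_scheme"
    and C :: "('g, 'n) monoid_scheme"
    and \<iota> :: "'k::field \<Rightarrow> 'l::field"
    and a :: "'g \<Rightarrow> ('l \<Rightarrow> 'l)"
    and b :: "('l \<Rightarrow> 'l) \<Rightarrow> 'g"
  assumes "skew_left_brace A C"
    and "finite (carrier A)"
    and "galois_extension \<iota>"
    and "a \<in> iso C (galois_group \<iota>)"
    and "b \<in> iso (galois_group \<iota>) C"
    and "\<forall>g \<in> carrier C. b (a g) = g"
    and "\<forall>\<gamma> \<in> carrier (galois_group \<iota>). a (b \<gamma>) = \<gamma>"
  shows "\<exists>\<Phi>. bij_betw \<Phi>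
           {B. sub_hopf_algebra B (brace_hopf_algebra \<iota> A a b)}
           {G'. circ_stable_subgroup A C G'}"
proof -
  interpret skew_left_brace A C by fact
  define \<Gamma> where "\<Gamma> = carrier (galois_group \<iota>)"
  have a_bij: "bij_betw a (carrier A) \<Gamma>"
    using assms(4) by (simp add: iso_def carrier_eq \<Gamma>_def)
  have b_closed: "b \<sigma> \<in> carrier A" if "\<sigma> \<in> \<Gamma>" for \<sigma>
    using assms(5) that by (auto simp: iso_def hom_def carrier_eq \<Gamma>_def)
  have ba: "b (a g) = g" if "g \<in> carrier A" for g
    using assms(6) that by (simp add: carrier_eq)
  have ab: "a (b \<sigma>) = \<sigma>" if "\<sigma> \<in> \<Gamma>" for \<sigma>
    using assms(7) that by (simp add: \<Gamma>_def)
  have a_mult: "a (g \<otimes>\<^bsub>C\<^esub> h) = a g \<circ> a h" if "g \<in> carrier A" "h \<in> carrier A" for g h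
    using assms(4) that by (auto simp: iso_def hom_def carrier_eq galois_group_def)
  interpret gal: group "galois_group \<iota>"
    by (rule galois_group_is_group)
  interpret P: group "BijGroup (carrier A)"
    by (rule group_BijGroup)
  interpret Q: group "BijGroup \<Gamma>"
    by (rule group_BijGroup)
  have "finite \<Gamma>"
    using assms(2) bij_betw_finite[OF a_bij] by simp
  then interpret finite_galois_extension \<iota>
    using assms(3) by unfold_locales (simp_all add: \<Gamma>_def)

  define \<Psi> where "\<Psi> = (\<lambda>p. compose \<Gamma> a (compose \<Gamma> p b))"
  have \<Psi>: "\<Psi> \<in> hom (BijGroup (carrier A)) (BijGroup \<Gamma>)"
    "inj_on \<Psi> (carrier (BijGroup (carrier A)))"
    using transport_BijGroup[of a "carrier A" \<Gamma> b] a_bij ba by (simp_all add: \<Psi>_def)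
  interpret \<Psi>: group_hom "BijGroup (carrier A)" "BijGroup \<Gamma>" \<Psi>
    by unfold_locales (rule \<Psi>(1))
  define \<alpha> where "\<alpha> g = \<Psi> (left_reg A g)" for g
  have \<alpha>_eq: "conj_left_reg A (galois_group \<iota>) a b = \<alpha>"
    by (auto simp: fun_eq_iff conj_left_reg_def \<alpha>_def \<Psi>_def \<Gamma>_def)
  have "\<alpha> \<in> hom A (BijGroup \<Gamma>)"
    using add.left_reg_closed add.left_reg_mult by (auto simp: hom_def \<alpha>_def)
  then interpret \<alpha>: group_hom A "BijGroup \<Gamma>" \<alpha>
    by unfold_locales
  have \<alpha>_inj: "inj_on \<alpha> (carrier A)"
    using add.left_reg_inj \<Psi>(2) add.left_reg_closed by (simp add: inj_on_def \<alpha>_def)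
  define N where "N = \<alpha> ` carrier A"

  have left_reg_\<Gamma>: "left_reg (galois_group \<iota>) \<sigma> = \<Psi> (left_reg C (b \<sigma>))" if \<sigma>: "\<sigma> \<in> \<Gamma>" for \<sigma>
  proof (rule BijGroup_eqI[of _ \<Gamma>])
    show "left_reg (galois_group \<iota>) \<sigma> \<in> carrier (BijGroup \<Gamma>)"
      using gal.left_reg_closed \<sigma> by (simp add: \<Gamma>_def)
    show "\<Psi> (left_reg C (b \<sigma>)) \<in> carrier (BijGroup \<Gamma>)"
      using circ.left_reg_closed b_closed[OF \<sigma>] by (simp add: carrier_eq)
    show "left_reg (galois_group \<iota>) \<sigma> \<tau> = \<Psi> (left_reg C (b \<sigma>)) \<tau>" if \<tau>: "\<tau> \<in> \<Gamma>" for \<tau>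
      using \<sigma> \<tau> b_closed[of \<sigma>] b_closed[of \<tau>]
      by (simp add: \<Psi>_def compose_def circ.left_reg_apply carrier_eq a_mult ab)
        (simp add: left_reg_def galois_group_def \<Gamma>_def)
  qed
  have conjugate_\<alpha>: "galois_conjugate \<iota> \<sigma> (\<alpha> g) = \<alpha> ((b \<sigma> \<otimes>\<^bsub>C\<^esub> g) \<otimes>\<^bsub>A\<^esub> inv\<^bsub>A\<^esub> b \<sigma>)"
    if "\<sigma> \<in> \<Gamma>" "g \<in> carrier A" for \<sigma> g
    using conjugate_left_reg[OF b_closed[OF that(1)] that(2)] left_reg_\<Gamma>[OF that(1)]
      circ.left_reg_closed[of "b \<sigma>"] add.left_reg_closed[OF that(2)] b_closed[OF that(1)]
    by (simp add: galois_conjugate_def \<alpha>_def carrier_eq flip: \<Gamma>_def \<Psi>.hom_inv \<Psi>.hom_mult)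
  have conj_closed: "(k \<otimes>\<^bsub>C\<^esub> g) \<otimes>\<^bsub>A\<^esub> inv\<^bsub>A\<^esub> k \<in> carrier A"
    if "k \<in> carrier A" "g \<in> carrier A" for k g
    using that circ.m_closed by (simp add: carrier_eq)

  interpret greither_pareigis \<iota> N
  proof (intro greither_pareigis.intro greither_pareigis_axioms.intro finite_galois_extension_axioms)
    show "subgroup N (BijGroup (carrier (galois_group \<iota>)))"
      unfolding N_def using \<alpha>.img_is_subgroup by (simp add: \<Gamma>_def)
    show "galois_conjugate \<iota> \<sigma> n \<in> N" if "\<sigma> \<in> carrier (galois_group \<iota>)" "n \<in> N" for \<sigma> n
      using that conjugate_\<alpha> conj_closed b_closed by (auto simp: N_def \<Gamma>_def)
  qed
  have "bij_betw ((`) \<alpha>) {G'. circ_stable_subgroup A C G'} {S. stable_subgroup S}"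
  proof (rule bij_betw_byWitness[of _ "\<lambda>S. {g \<in> carrier A. \<alpha> g \<in> S}"])
    have preimage_image: "{g \<in> carrier A. \<alpha> g \<in> \<alpha> ` G'} = G'" if "G' \<subseteq> carrier A" for G'
      using that \<alpha>_inj by (auto simp: inj_on_def)
    have image_preimage: "\<alpha> ` {g \<in> carrier A. \<alpha> g \<in> S} = S" if "S \<subseteq> N" for S
      using that by (auto simp: N_def)
    show "\<forall>G'\<in>{G'. circ_stable_subgroup A C G'}. {g \<in> carrier A. \<alpha> g \<in> \<alpha> ` G'} = G'"
      by (auto intro!: preimage_image[OF subgroup.subset]
          simp only: circ_stable_subgroup_iff mem_Collect_eq)
    show "\<forall>S\<in>{S. stable_subgroup S}. \<alpha> ` {g \<in> carrier A. \<alpha> g \<in> S} = S"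
      using image_preimage by (simp add: stable_subgroup_iff)
    show "(`) \<alpha> ` {G'. circ_stable_subgroup A C G'} \<subseteq> {S. stable_subgroup S}"
    proof clarify
      fix G' assume "circ_stable_subgroup A C G'"
      then have G': "subgroup G' A" "G' \<subseteq> carrier A"
        and stable: "\<And>k g. k \<in> carrier A \<Longrightarrow> g \<in> G' \<Longrightarrow> (k \<otimes>\<^bsub>C\<^esub> g) \<otimes>\<^bsub>A\<^esub> inv\<^bsub>A\<^esub> k \<in> G'"
        by (auto simp: circ_stable_subgroup_iff dest: subgroup.subset)
      have "subgroup (\<alpha> ` G') (BijGroup \<Gamma>)"
        by (rule \<alpha>.subgroup_img_is_subgroup[OF G'(1)])
      moreover have "galois_conjugate \<iota> \<sigma> n \<in> \<alpha> ` G'" if "\<sigma> \<in> \<Gamma>" "n \<in> \<alpha> ` G'" for \<sigma> n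
        using that G'(2) conjugate_\<alpha> stable b_closed by auto
      moreover have "\<alpha> ` G' \<subseteq> N"
        using G'(2) by (auto simp: N_def)
      ultimately show "stable_subgroup (\<alpha> ` G')"
        by (auto simp: stable_subgroup_iff \<Gamma>_def)
    qed
    show "(\<lambda>S. {g \<in> carrier A. \<alpha> g \<in> S}) ` {S. stable_subgroup S}
        \<subseteq> {G'. circ_stable_subgroup A C G'}"
    proof clarify
      fix S assume "stable_subgroup S"
      then have S: "subgroup S (BijGroup \<Gamma>)"
        "\<And>\<sigma> n. \<sigma> \<in> \<Gamma> \<Longrightarrow> n \<in> S \<Longrightarrow> galois_conjugate \<iota> \<sigma> n \<in> S"
        by (auto simp: stable_subgroup_iff \<Gamma>_def)
      interpret S: subgroup S "BijGroup \<Gamma>" by (rule S(1))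
      have "subgroup {g \<in> carrier A. \<alpha> g \<in> S} A"
        by (rule subgroup.intro) (auto simp: \<alpha>.hom_inv)
      moreover have "\<alpha> ((k \<otimes>\<^bsub>C\<^esub> g) \<otimes>\<^bsub>A\<^esub> inv\<^bsub>A\<^esub> k) \<in> S"
        if "k \<in> carrier A" "g \<in> carrier A" "\<alpha> g \<in> S" for k g
      proof -
        have "a k \<in> \<Gamma>"
          using a_bij that(1) by (auto simp: bij_betw_def)
        then show ?thesis
          using S(2)[of "a k" "\<alpha> g"] conjugate_\<alpha>[of "a k" g] that by (simp add: ba)
      qed
      ultimately show "circ_stable_subgroup A C {g \<in> carrier A. \<alpha> g \<in> S}"
        by (simp add: circ_stable_subgroup_iff conj_closed)
    qed
  qed
  then have "bij_betw (supported \<circ> (`) \<alpha>) {G'. circ_stable_subgroup A C G'}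
      {B. sub_hopf_algebra B (brace_hopf_algebra \<iota> A a b)}"
    using bij_betw_trans[OF _ bij_betw_supported]
    by (simp add: brace_hopf_algebra_def \<alpha>_eq descent_hopf_algebra_eq flip: N_def)
  then show ?thesis
    using bij_betw_inv_into by blast
qed

end
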